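(* Let $\mathcal{A}\subseteq L^2(\mathcal{X})$ be a (finite or) countable set, let $V=S_\sigma^\Gamma(\mathcal{A})$, let $J(\alpha)=\overline{\mathrm{span}}\{Z_\sigma[\phi](\alpha):\phi\in\mathcal{A}\}\subseteq L^2(C)$ (for a.e. $\alpha\in\widehat{\Gamma}$) be the measurable range function associated to $V$, and let $0<A\le B<+\infty$. The following two conditions are equivalent: (i) $E_\sigma^\Gamma(\mathcal{A})=\{\Pi_\sigma(\gamma)\phi\}_{\gamma\in\Gamma,\phi\in\mathcal{A}}$ is a Riesz basis for $V$ with bounds $A,B$. (ii) For almost every $\alpha\in\widehat{\Gamma}$, the system $\{Z_\sigma[\phi](\alpha)\}_{\phi\in\mathcal{A}}$ is a Riesz basis for $J(\alpha)$ with (uniform) bounds $A,B$.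
   Context: Setting. $\Gamma$ is a countable discrete abelian group (written additively, identity $e$), $\widehat{\Gamma}$ is its (compact) dual group with Haar measure $m_{\widehat{\Gamma}}$ normalized by $m_{\widehat{\Gamma}}(\widehat{\Gamma})=1$, and $(\gamma,\alpha)$ denotes the value of the character $\alpha\in\widehat{\Gamma}$ at $\gamma\in\Gamma$. $(\mathcal{X},\mu)$ is a $\sigma$-finite measure space with $L^2(\mathcal{X})=L^2(\mathcal{X},\mu)$ separable. $\sigma:\Gamma\times\mathcal{X}\to\mathcal{X}$ is an action: each $\sigma_\gamma:=\sigma(\gamma,\cdot)$ is measurable, $\sigma_\gamma\circ\sigma_{\gamma'}=\sigma_{\gamma+\gamma'}$, and $\sigma_e$ is the identity. The action is quasi-$\Gamma$-invariant: there is a measurable function $J_\sigma:\Gamma\times\mathcal{X}\to(0,\infty)$ (the Jacobian) with $d\mu(\sigma_\gamma(x))=J_\sigma(\gamma,x)\,d\mu(x)$, i.e. $\mu(\sigma_\gamma(E))=\int_E J_\sigma(\gamma,x)\,d\mu(x)$ for measurable $E$. The action has the tiling property with tiling set $C$: $C\subseteq\mathcal{X}$ is measurable, $\mu(\sigma_\gamma(C)\cap\sigma_{\gamma'}(C))=0$ for $\gamma\ne\gamma'$, and $\mu(\mathcal{X}\setminus\bigcup_{\gamma\in\Gamma}\sigma_\gamma(C))=0$. $L^2(C)$ is taken with respect to $\mu|_C$. The associated unitary representation of $\Gamma$ on $L^2(\mathcal{X})$ is $\Pi_\sigma(\gamma)\psi(x)=J_\sigma(-\gamma,x)^{1/2}\psi(\sigma_{-\gamma}(x))$,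 and $S_\sigma^\Gamma(\mathcal{A})=\overline{\mathrm{span}}\{\Pi_\sigma(\gamma)\phi:\phi\in\mathcal{A},\gamma\in\Gamma\}$. The generalized Zak transform is the isometric isomorphism $Z_\sigma:L^2(\mathcal{X})\to L^2(\widehat{\Gamma},L^2(C))$, $Z_\sigma[\psi](\alpha)(x)=\sum_{\gamma\in\Gamma}[(\Pi_\sigma(\gamma)\psi)(x)]\,(-\gamma,\alpha)$, the sum being the $\ell^2(\Gamma)\to L^2(\widehat\Gamma)$ Fourier transform of the sequence $\{(\Pi_\sigma(\gamma)\psi)(x)\}_{\gamma\in\Gamma}$, which is in $\ell^2(\Gamma)$ for a.e. $x$. A finite or countable family $\{f_i\}_{i\in I}$ in a separable Hilbert space $\mathcal{H}$ is a Riesz basis for $\mathcal{H}$ with bounds $0<A\le B<\infty$ if it is complete in $\mathcal{H}$ (its span is dense) and $A\sum_{i\in I}|a_i|^2\le\|\sum_{i\in I}a_if_i\|^2\le B\sum_{i\in I}|a_i|^2$ for all finitely supported scalar sequences $\{a_i\}_{i\in I}$. *)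

theory Defs
  imports "HOL-Analysis.Analysis"
begin

text \<open>Elements of $L^2$ are represented by square-integrable functions, not by classes modulo
  a.e. equality; accordingly the norm below is a seminorm, and closed subspaces are sets of
  functions closed under a.e. equality.\<close>

definition L2 :: "'a measure \<Rightarrow> ('a \<Rightarrow> complex) set" where
  "L2 M = {f \<in> borel_measurable M. integrable M (\<lambda>x. (norm (f x))\<^sup>2)}"

definition L2_norm :: "'a measure \<Rightarrow> ('a \<Rightarrow> complex) \<Rightarrow> real" where
  "L2_norm M f = sqrt (\<integral>x. (norm (f x))\<^sup>2 \<partial>M)"

definition L2_separable :: "'a measure \<Rightarrow> bool" where
  "L2_separable M \<longleftrightarrow> (\<exists>D. countable D \<and> D \<subseteq> L2 M \<and>
     (\<forall>f\<in>L2 M. \<forall>\<epsilon>>0. \<exists>d\<in>D. L2_norm M (\<lambda>x. f x - d x) < \<epsilon>))"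

definition lin_span :: "('a \<Rightarrow> complex) set \<Rightarrow> ('a \<Rightarrow> complex) set" where
  "lin_span S = {\<lambda>x. \<Sum>f\<in>F. a f * f x | F a. finite F \<and> F \<subseteq> S}"

definition L2_closed_span :: "'a measure \<Rightarrow> ('a \<Rightarrow> complex) set \<Rightarrow> ('a \<Rightarrow> complex) set" where
  "L2_closed_span M S =
     {g \<in> L2 M. \<forall>\<epsilon>>0. \<exists>h\<in>lin_span S. L2_norm M (\<lambda>x. g x - h x) < \<epsilon>}"

text \<open>\<open>H\<close> stands for a closed subspace of $L^2(M)$, regarded as a Hilbert space.\<close>

definition riesz_basis ::
  "'a measure \<Rightarrow> ('a \<Rightarrow> complex) set \<Rightarrow> 'i set \<Rightarrow> ('i \<Rightarrow> 'a \<Rightarrow> complex) \<Rightarrow> real \<Rightarrow> real \<Rightarrow> bool" where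
  "riesz_basis M H I f A B \<longleftrightarrow>
     countable I \<and> 0 < A \<and> A \<le> B \<and>
     f ` I \<subseteq> H \<and> H \<subseteq> L2_closed_span M (f ` I) \<and>
     (\<forall>F a. finite F \<and> F \<subseteq> I \<longrightarrow>
        A * (\<Sum>i\<in>F. (norm (a i))\<^sup>2) \<le> (L2_norm M (\<lambda>x. \<Sum>i\<in>F. a i * f i x))\<^sup>2 \<and>
        (L2_norm M (\<lambda>x. \<Sum>i\<in>F. a i * f i x))\<^sup>2 \<le> B * (\<Sum>i\<in>F. (norm (a i :: complex))\<^sup>2))"

text \<open>The pairing $(\gamma,\alpha)$ is the application \<open>\<alpha> \<gamma>\<close>. The group is discrete, so every
  homomorphism into the circle is continuous.\<close>

definition dual_group :: "('g::ab_group_add \<Rightarrow> complex) set" where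
  "dual_group = {\<alpha>. (\<forall>\<gamma> \<gamma>'. \<alpha> (\<gamma> + \<gamma>') = \<alpha> \<gamma> * \<alpha> \<gamma>') \<and> (\<forall>\<gamma>. norm (\<alpha> \<gamma>) = 1)}"

text \<open>The dual carries the topology of pointwise convergence, i.e. the subspace topology from the
  product topology on the function type. For a countable group it is compact and metrizable, so
  every finite Borel measure on it is regular and regularity need not be demanded.\<close>

definition normalized_haar :: "('g::{ab_group_add,countable} \<Rightarrow> complex) measure \<Rightarrow> bool" where
  "normalized_haar m \<longleftrightarrow>
     sets m = sets (restrict_space borel dual_group) \<and>
     emeasure m dual_group = 1 \<and>
     (\<forall>\<beta>\<in>dual_group. \<forall>E\<in>sets m. emeasure m ((\<lambda>\<alpha> \<gamma>. \<beta> \<gamma> * \<alpha> \<gamma>) ` E) = emeasure m E)"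

definition measurable_action :: "'x measure \<Rightarrow> ('g::ab_group_add \<Rightarrow> 'x \<Rightarrow> 'x) \<Rightarrow> bool" where
  "measurable_action M \<sigma> \<longleftrightarrow>
     (\<forall>\<gamma>. \<sigma> \<gamma> \<in> measurable M M) \<and>
     (\<forall>\<gamma> \<gamma>'. \<forall>x\<in>space M. \<sigma> \<gamma> (\<sigma> \<gamma>' x) = \<sigma> (\<gamma> + \<gamma>') x) \<and>
     (\<forall>x\<in>space M. \<sigma> 0 x = x)"

definition is_jacobian ::
  "'x measure \<Rightarrow> ('g::ab_group_add \<Rightarrow> 'x \<Rightarrow> 'x) \<Rightarrow> ('g \<Rightarrow> 'x \<Rightarrow> real) \<Rightarrow> bool" where
  "is_jacobian M \<sigma> J \<longleftrightarrow>
     (\<lambda>(\<gamma>, x). J \<gamma> x) \<in> borel_measurable (count_space UNIV \<Otimes>\<^sub>M M) \<and>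
     (\<forall>\<gamma>. \<forall>x\<in>space M. 0 < J \<gamma> x) \<and>
     (\<forall>\<gamma>. \<forall>E\<in>sets M. emeasure M (\<sigma> \<gamma> ` E) = (\<integral>\<^sup>+x\<in>E. ennreal (J \<gamma> x) \<partial>M))"

definition tiling_set :: "'x measure \<Rightarrow> ('g::ab_group_add \<Rightarrow> 'x \<Rightarrow> 'x) \<Rightarrow> 'x set \<Rightarrow> bool" where
  "tiling_set M \<sigma> C \<longleftrightarrow>
     C \<in> sets M \<and>
     (\<forall>\<gamma> \<gamma>'. \<gamma> \<noteq> \<gamma>' \<longrightarrow> emeasure M (\<sigma> \<gamma> ` C \<inter> \<sigma> \<gamma>' ` C) = 0) \<and>
     emeasure M (space M - (\<Union>\<gamma>. \<sigma> \<gamma> ` C)) = 0"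

definition action_rep ::
  "('g::ab_group_add \<Rightarrow> 'x \<Rightarrow> 'x) \<Rightarrow> ('g \<Rightarrow> 'x \<Rightarrow> real) \<Rightarrow> 'g \<Rightarrow> ('x \<Rightarrow> complex) \<Rightarrow> 'x \<Rightarrow> complex" where
  "action_rep \<sigma> J \<gamma> \<psi> x = complex_of_real (sqrt (J (- \<gamma>) x)) * \<psi> (\<sigma> (- \<gamma>) x)"

definition invariant_span ::
  "'x measure \<Rightarrow> ('g::ab_group_add \<Rightarrow> 'x \<Rightarrow> 'x) \<Rightarrow> ('g \<Rightarrow> 'x \<Rightarrow> real) \<Rightarrow> ('x \<Rightarrow> complex) set
     \<Rightarrow> ('x \<Rightarrow> complex) set" where
  "invariant_span M \<sigma> J \<A> = L2_closed_span M {action_rep \<sigma> J \<gamma> \<phi> | \<gamma> \<phi>. \<phi> \<in> \<A>}"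

text \<open>\<open>F\<close> is (a representative of) the $\ell^2 \to L^2$ Fourier transform of \<open>c\<close>: the unconditional
  $L^2$-limit of the finite partial sums. It exists exactly when \<open>c\<close> is square-summable.\<close>

definition is_L2_fourier ::
  "('g::ab_group_add \<Rightarrow> complex) measure \<Rightarrow> ('g \<Rightarrow> complex) \<Rightarrow> (('g \<Rightarrow> complex) \<Rightarrow> complex) \<Rightarrow> bool" where
  "is_L2_fourier m c F \<longleftrightarrow>
     F \<in> L2 m \<and>
     ((\<lambda>K. L2_norm m (\<lambda>\<alpha>. F \<alpha> - (\<Sum>\<gamma>\<in>K. c \<gamma> * \<alpha> (- \<gamma>)))) \<longlongrightarrow> 0) (finite_subsets_at_top UNIV)"

text \<open>An element of $L^2(\widehat\Gamma, L^2(C))$ is represented by a jointly measurable function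
  of $(\alpha, x)$, square-integrable on the product. The Zak transform is determined up to a null
  set of the product; hence, for almost every $\alpha$, its value at $\alpha$ is determined as an
  element of $L^2(C)$. The choice operator picks one representative.\<close>

definition is_zak ::
  "('g::ab_group_add \<Rightarrow> complex) measure \<Rightarrow> 'x measure \<Rightarrow> ('g \<Rightarrow> 'x \<Rightarrow> 'x) \<Rightarrow> ('g \<Rightarrow> 'x \<Rightarrow> real)
     \<Rightarrow> 'x set \<Rightarrow> ('x \<Rightarrow> complex) \<Rightarrow> (('g \<Rightarrow> complex) \<Rightarrow> 'x \<Rightarrow> complex) \<Rightarrow> bool" where
  "is_zak m M \<sigma> J C \<psi> Z \<longleftrightarrow>
     (\<lambda>(\<alpha>, x). Z \<alpha> x) \<in> L2 (m \<Otimes>\<^sub>M restrict_space M C) \<and>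
     (AE x in restrict_space M C. is_L2_fourier m (\<lambda>\<gamma>. action_rep \<sigma> J \<gamma> \<psi> x) (\<lambda>\<alpha>. Z \<alpha> x))"

definition zak ::
  "('g::ab_group_add \<Rightarrow> complex) measure \<Rightarrow> 'x measure \<Rightarrow> ('g \<Rightarrow> 'x \<Rightarrow> 'x) \<Rightarrow> ('g \<Rightarrow> 'x \<Rightarrow> real)
     \<Rightarrow> 'x set \<Rightarrow> ('x \<Rightarrow> complex) \<Rightarrow> ('g \<Rightarrow> complex) \<Rightarrow> 'x \<Rightarrow> complex" where
  "zak m M \<sigma> J C \<psi> = (SOME Z. is_zak m M \<sigma> J C \<psi> Z)"

definition range_function ::
  "('g::ab_group_add \<Rightarrow> complex) measure \<Rightarrow> 'x measure \<Rightarrow> ('g \<Rightarrow> 'x \<Rightarrow> 'x) \<Rightarrow> ('g \<Rightarrow> 'x \<Rightarrow> real)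
     \<Rightarrow> 'x set \<Rightarrow> ('x \<Rightarrow> complex) set \<Rightarrow> ('g \<Rightarrow> complex) \<Rightarrow> ('x \<Rightarrow> complex) set" where
  "range_function m M \<sigma> J C \<A> \<alpha> =
     L2_closed_span (restrict_space M C) {zak m M \<sigma> J C \<phi> \<alpha> | \<phi>. \<phi> \<in> \<A>}"

end

theory Submission imports Defs begin

text \<open>
  By the tiling property and the cocycle identity of the Jacobian, the Zak transform is an isometry
  which turns \<open>\<Pi>(\<gamma>)\<close> into multiplication by the character \<open>\<alpha> \<mapsto> (\<gamma>, \<alpha>)\<close>. Hence a finite
  combination of the \<open>\<Pi>(\<gamma>) \<phi>\<close> has squared norm
  \<open>\<integral> \<parallel>\<Sum> p\<^sub>\<phi>(\<alpha>) Z[\<phi>](\<alpha>)\<parallel>\<^sup>2 d\<alpha>\<close> with trigonometric polynomials \<open>p\<^sub>\<phi>\<close>, while the squared norm of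
  its coefficients is \<open>\<integral> \<Sum> \<bar>p\<^sub>\<phi>(\<alpha>)\<bar>\<^sup>2 d\<alpha>\<close>. Integrating the fibrewise bounds gives (i). Conversely,
  taking \<open>p\<^sub>\<phi> = c\<^sub>\<phi> p\<close>, the bounds in (i) say that \<open>\<integral> \<bar>p\<bar>\<^sup>2 h \<ge> 0\<close> for every trigonometric
  polynomial \<open>p\<close>, where \<open>h\<close> is the defect of the fibrewise bound at the vector \<open>c\<close>. Stone--Weierstrass
  and inner regularity give \<open>h \<ge> 0\<close> almost everywhere, first for \<open>c\<close> in a countable dense set and
  then for all \<open>c\<close> by continuity in \<open>c\<close>.
\<close>

section \<open>Square-integrable functions\<close>

text \<open>The completeness clause of \<open>riesz_basis\<close> costs nothing, since V and the
  fibres J(\<alpha>) are closed spans of the very systems in question; only the two-sided inequality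
  has content. In (ii) one null set must serve all finite subsets and all coefficients, whereas (i)
  yields an exceptional set for each coefficient vector; hence the detour through countably many
  vectors. Positivity against every |p|^2 extends to nonnegative continuous weights f by
  approximating the square root of f, not f itself. Two facts behind the overview need substantial
  proofs. Characters must separate the points of \<Gamma>, which underlies their orthonormality and
  so Parseval's identity; this is done by extending partial characters with Zorn's lemma. The Zak
  transform must exist, since \<open>zak\<close> is a choice and says nothing until a candidate is
  built. As that choice is made for each function separately, linearity of \<open>zak\<close> is
  never invoked: the isometry is proved directly for finite combinations. Norm identities are
  computed with the extended-valued \<open>L2_energy\<close>, so that Tonelli's theorem applies
  without integrability conditions.\<close>

definition L2_energy :: "'a measure \<Rightarrow> ('a \<Rightarrow> complex) \<Rightarrow> ennreal" where
  "L2_energy M f = (\<integral>\<^sup>+x. ennreal ((norm (f x))\<^sup>2) \<partial>M)"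

lemma L2_measurable [measurable_dest]: "f \<in> L2 M \<Longrightarrow> f \<in> borel_measurable M"
  by (simp add: L2_def)

lemma L2_iff_energy: "f \<in> L2 M \<longleftrightarrow> f \<in> borel_measurable M \<and> L2_energy M f < \<infinity>"
  unfolding L2_def L2_energy_def by (auto simp: integrable_iff_bounded)

lemma L2_energy_eq: "f \<in> L2 M \<Longrightarrow> L2_energy M f = ennreal ((L2_norm M f)\<^sup>2)"
  unfolding L2_def L2_energy_def L2_norm_def
  by (subst nn_integral_eq_integral) auto

text \<open>Square integrability is not assumed: for infinite energy the Bochner integral and
  \<open>enn2real\<close> both default to 0. Measurability of fibre norms can thus be shown without
  removing a null set.\<close>

lemma L2_norm_eq_energy: "f \<in> borel_measurable M \<Longrightarrow> (L2_norm M f)\<^sup>2 = enn2real (L2_energy M f)"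
  unfolding L2_energy_def L2_norm_def
  by (simp add: integral_eq_nn_integral)

lemma L2_norm_nonneg [simp]: "0 \<le> L2_norm M f"
  by (simp add: L2_norm_def)

lemma norm_add_sq_le: "(norm (a + b :: 'a::real_normed_vector))\<^sup>2 \<le> 2 * (norm a)\<^sup>2 + 2 * (norm b)\<^sup>2"
proof -
  have "(norm (a + b))\<^sup>2 \<le> (norm a + norm b)\<^sup>2"
    by (simp add: norm_triangle_ineq power_mono)
  also have "\<dots> \<le> 2 * (norm a)\<^sup>2 + 2 * (norm b)\<^sup>2"
    using sum_squares_bound[of "norm a" "norm b"] by (simp add: power2_sum)
  finally show ?thesis .
qed

lemma L2_energy_add_le:
  assumes [measurable]: "f \<in> borel_measurable M" "g \<in> borel_measurable M"
  shows "L2_energy M (\<lambda>x. f x + g x) \<le> 2 * L2_energy M f + 2 * L2_energy M g"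
proof -
  have "L2_energy M (\<lambda>x. f x + g x) \<le> (\<integral>\<^sup>+x. 2 * ennreal ((norm (f x))\<^sup>2) + 2 * ennreal ((norm (g x))\<^sup>2) \<partial>M)"
    unfolding L2_energy_def
  proof (rule nn_integral_mono)
    fix x
    have "ennreal ((norm (f x + g x))\<^sup>2) \<le> ennreal (2 * (norm (f x))\<^sup>2 + 2 * (norm (g x))\<^sup>2)"
      by (intro ennreal_leI norm_add_sq_le)
    then show "ennreal ((norm (f x + g x))\<^sup>2) \<le> 2 * ennreal ((norm (f x))\<^sup>2) + 2 * ennreal ((norm (g x))\<^sup>2)"
      by (simp add: ennreal_plus ennreal_mult)
  qed
  also have "\<dots> = 2 * L2_energy M f + 2 * L2_energy M g"
    unfolding L2_energy_def by (simp add: nn_integral_add nn_integral_cmult)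
  finally show ?thesis .
qed

lemma L2_energy_scale:
  assumes [measurable]: "f \<in> borel_measurable M"
  shows "L2_energy M (\<lambda>x. c * f x) = ennreal ((norm c)\<^sup>2) * L2_energy M f"
  unfolding L2_energy_def
  by (simp add: norm_mult power_mult_distrib ennreal_mult nn_integral_cmult)

lemma L2_add: "f \<in> L2 M \<Longrightarrow> g \<in> L2 M \<Longrightarrow> (\<lambda>x. f x + g x) \<in> L2 M"
  unfolding L2_iff_energy
  by (auto intro: le_less_trans[OF L2_energy_add_le] simp: ennreal_mult_less_top)

lemma L2_scale: "f \<in> L2 M \<Longrightarrow> (\<lambda>x. c * f x) \<in> L2 M"
  unfolding L2_iff_energy by (auto simp: L2_energy_scale ennreal_mult_less_top)

lemma L2_zero: "(\<lambda>x. 0) \<in> L2 M"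
  by (simp add: L2_def)

lemma L2_sum: "(\<And>i. i \<in> F \<Longrightarrow> f i \<in> L2 M) \<Longrightarrow> (\<lambda>x. \<Sum>i\<in>F. f i x) \<in> L2 M"
  by (induction F rule: infinite_finite_induct) (simp_all add: L2_zero L2_add)

lemma L2_sum_scale: "(\<And>i. i \<in> F \<Longrightarrow> f i \<in> L2 M) \<Longrightarrow> (\<lambda>x. \<Sum>i\<in>F. a i * f i x) \<in> L2 M"
  by (intro L2_sum L2_scale)

lemma L2_diff: "f \<in> L2 M \<Longrightarrow> g \<in> L2 M \<Longrightarrow> (\<lambda>x. f x - g x) \<in> L2 M"
  using L2_add[of f M "\<lambda>x. (-1) * g x"] L2_scale[of g M "-1"] by simp

lemma L2_norm_scale: "L2_norm M (\<lambda>x. c * f x) = norm c * L2_norm M f"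
  by (simp add: L2_norm_def norm_mult power_mult_distrib real_sqrt_mult)

text \<open>Minkowski's inequality: Cauchy-Schwarz bounds the integral of |f||g|, the cross term of
  the expanded square.\<close>

lemma L2_norm_triangle:
  assumes f: "f \<in> L2 M" and g: "g \<in> L2 M"
  shows "L2_norm M (\<lambda>x. f x + g x) \<le> L2_norm M f + L2_norm M g"
proof -
  note [measurable] = L2_measurable[OF f] L2_measurable[OF g]
  let ?a = "L2_norm M f" and ?b = "L2_norm M g"
  let ?P = "\<integral>\<^sup>+x. ennreal (norm (f x)) * ennreal (norm (g x)) \<partial>M"
  have "?P\<^sup>2 \<le> L2_energy M f * L2_energy M g"
    using Cauchy_Schwarz_nn_integral[of "\<lambda>x. ennreal (norm (f x))" M "\<lambda>x. ennreal (norm (g x))"]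
    by (simp add: L2_energy_def ennreal_power)
  also have "\<dots> = (ennreal (?a * ?b))\<^sup>2"
    by (simp add: L2_energy_eq f g ennreal_power ennreal_mult power_mult_distrib)
  finally have P: "?P \<le> ennreal (?a * ?b)"
    by (cases ?P) (auto simp: ennreal_power power2_le_iff_abs_le top_unique)
  have "ennreal ((L2_norm M (\<lambda>x. f x + g x))\<^sup>2) = L2_energy M (\<lambda>x. f x + g x)"
    by (simp add: L2_energy_eq f g L2_add)
  also have "\<dots> \<le> (\<integral>\<^sup>+x. (ennreal ((norm (f x))\<^sup>2) + ennreal ((norm (g x))\<^sup>2))
      + 2 * (ennreal (norm (f x)) * ennreal (norm (g x))) \<partial>M)"
    unfolding L2_energy_def
  proof (rule nn_integral_mono)
    fix x
    have "(norm (f x + g x))\<^sup>2 \<le> (norm (f x) + norm (g x))\<^sup>2"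
      by (simp add: norm_triangle_ineq power_mono)
    also have "\<dots> = (norm (f x))\<^sup>2 + (norm (g x))\<^sup>2 + 2 * (norm (f x) * norm (g x))"
      by (simp add: power2_sum)
    finally have "ennreal ((norm (f x + g x))\<^sup>2) \<le> ennreal \<dots>"
      by (rule ennreal_leI)
    then show "ennreal ((norm (f x + g x))\<^sup>2) \<le> (ennreal ((norm (f x))\<^sup>2) + ennreal ((norm (g x))\<^sup>2))
      + 2 * (ennreal (norm (f x)) * ennreal (norm (g x)))"
      by (simp add: ennreal_plus ennreal_mult)
  qed
  also have "\<dots> = L2_energy M f + L2_energy M g + 2 * ?P"
    by (simp add: L2_energy_def nn_integral_add nn_integral_cmult)
  also have "\<dots> \<le> L2_energy M f + L2_energy M g + 2 * ennreal (?a * ?b)"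
    using P by (intro add_left_mono mult_left_mono) auto
  also have "\<dots> = ennreal ((?a + ?b)\<^sup>2)"
    by (simp add: L2_energy_eq f g power2_sum ennreal_plus ennreal_mult mult.assoc)
  finally have "(L2_norm M (\<lambda>x. f x + g x))\<^sup>2 \<le> (?a + ?b)\<^sup>2"
    by simp
  then show ?thesis
    by (rule power2_le_imp_le) simp
qed

lemma L2_norm_diff_bound:
  assumes f: "f \<in> L2 M" and g: "g \<in> L2 M"
  shows "\<bar>L2_norm M f - L2_norm M g\<bar> \<le> L2_norm M (\<lambda>x. f x - g x)"
proof -
  have "L2_norm M f \<le> L2_norm M (\<lambda>x. f x - g x) + L2_norm M g"
    using L2_norm_triangle[OF L2_diff[OF f g] g] by simp
  moreover have "L2_norm M g \<le> L2_norm M (\<lambda>x. g x - f x) + L2_norm M f"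
    using L2_norm_triangle[OF L2_diff[OF g f] f] by simp
  moreover have "L2_norm M (\<lambda>x. g x - f x) = L2_norm M (\<lambda>x. f x - g x)"
    by (simp add: L2_norm_def norm_minus_commute)
  ultimately show ?thesis by linarith
qed

lemma L2_norm_sum_le:
  assumes "\<And>i. i \<in> F \<Longrightarrow> f i \<in> L2 M"
  shows "L2_norm M (\<lambda>x. \<Sum>i\<in>F. f i x) \<le> (\<Sum>i\<in>F. L2_norm M (f i))"
  using assms
proof (induction F rule: infinite_finite_induct)
  case (insert i F)
  then show ?case
    using L2_norm_triangle[of "f i" M "\<lambda>x. \<Sum>i\<in>F. f i x"] by (force simp: L2_sum)
qed (simp_all add: L2_norm_def)

lemma L2_energy_tendsto_norm:
  assumes "\<And>K. f K \<in> L2 M" "((\<lambda>K. L2_energy M (f K)) \<longlongrightarrow> 0) G"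
  shows "((\<lambda>K. L2_norm M (f K)) \<longlongrightarrow> 0) G"
proof -
  have "((\<lambda>K. (L2_norm M (f K))\<^sup>2) \<longlongrightarrow> 0) G"
    using assms(2) by (simp add: L2_energy_eq[OF assms(1)] tendsto_ennreal_iff flip: ennreal_0)
  then have "((\<lambda>K. sqrt ((L2_norm M (f K))\<^sup>2)) \<longlongrightarrow> sqrt 0) G"
    by (rule tendsto_real_sqrt)
  then show ?thesis by simp
qed

text \<open>Riesz-Fischer with a rate. Geometric decay of the energies makes the increments summable
  at almost every point; Fatou's lemma then passes the bound to the limit. Only differences need
  finite energy, not the \<open>T k\<close> themselves.\<close>

lemma L2_complete:
  assumes meas [measurable]: "\<And>k. T k \<in> borel_measurable M"
    and Cauchy: "\<And>k j. k \<le> j \<Longrightarrow> L2_energy M (\<lambda>x. T j x - T k x) \<le> ennreal ((1/4)^k)"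
  obtains Z where "Z \<in> borel_measurable M"
    "\<And>k. L2_energy M (\<lambda>x. Z x - T k x) \<le> ennreal ((1/4)^k)"
proof
  let ?Z = "\<lambda>x. lim (\<lambda>k. T k x)"
  show Z [measurable]: "?Z \<in> borel_measurable M" by measurable
  \<comment> \<open>The squared increments are weighted by 2^k: the integrals stay summable, as 2^k
    (1/4)^k = (1/2)^k, and pointwise the weight buys summability of the increments
    themselves.\<close>
  let ?d = "\<lambda>k x. norm (T (Suc k) x - T k x)"
  have "(\<integral>\<^sup>+x. (\<Sum>k. ennreal (2^k * (?d k x)\<^sup>2)) \<partial>M) = (\<Sum>k. \<integral>\<^sup>+x. ennreal (2^k * (?d k x)\<^sup>2) \<partial>M)"
    by (rule nn_integral_suminf) simp
  also have "\<dots> = (\<Sum>k. ennreal (2^k) * L2_energy M (\<lambda>x. T (Suc k) x - T k x))"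
    by (simp add: ennreal_mult nn_integral_cmult L2_energy_def)
  also have "\<dots> \<le> (\<Sum>k. ennreal ((1/2)^k))"
  proof (rule suminf_le)
    fix k
    have "ennreal (2^k) * L2_energy M (\<lambda>x. T (Suc k) x - T k x) \<le> ennreal (2^k) * ennreal ((1/4)^k)"
      by (intro mult_left_mono Cauchy) auto
    also have "\<dots> = ennreal ((1/2)^k)"
      by (simp add: power_mult_distrib[symmetric] flip: ennreal_mult)
    finally show "ennreal (2^k) * L2_energy M (\<lambda>x. T (Suc k) x - T k x) \<le> ennreal ((1/2)^k)" .
  qed auto
  also have "\<dots> < \<infinity>"
    by (subst suminf_ennreal2) (auto intro: summable_geometric)
  finally have "AE x in M. (\<Sum>k. ennreal (2^k * (?d k x)\<^sup>2)) \<noteq> \<infinity>"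
    by (intro nn_integral_noteq_infinite) auto
  then have conv: "AE x in M. (\<lambda>k. T k x) \<longlonglongrightarrow> ?Z x"
  proof eventually_elim
    case (elim x)
    then have s: "summable (\<lambda>k. 2^k * (?d k x)\<^sup>2)"
      by (intro summable_suminf_not_top) auto
    have "summable (\<lambda>k. ?d k x)"
    proof (rule summable_comparison_test')
      show "summable (\<lambda>k. 2^k * (?d k x)\<^sup>2 + (1/2)^k)"
        using s by (intro summable_add summable_geometric) auto
      fix k
      \<comment> \<open>Arithmetic-geometric mean inequality in the form 2 d <= 2^k d^2 +
        2^(-k).\<close>
      have "0 \<le> 2^k * (?d k x - (1/2)^k)\<^sup>2" by simp
      also have "\<dots> = 2^k * (?d k x)\<^sup>2 + (1/2)^k - 2 * ?d k x"
        by (simp add: power2_diff field_simps power2_eq_square)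
      finally show "norm (?d k x) \<le> 2^k * (?d k x)\<^sup>2 + (1/2)^k"
        by simp (smt (verit) norm_ge_zero)
    qed
    then have "summable (\<lambda>k. T (Suc k) x - T k x)"
      by (rule summable_norm_cancel)
    then have "convergent (\<lambda>n. \<Sum>k<n. T (Suc k) x - T k x)"
      by (simp add: summable_iff_convergent)
    then have "convergent (\<lambda>n. T n x - T 0 x)"
      by (simp only: sum_lessThan_telescope[of "\<lambda>k. T k x"])
    then have "convergent (\<lambda>n. (T n x - T 0 x) + T 0 x)"
      by (intro convergent_add convergent_const)
    then show ?case by (simp add: convergent_LIMSEQ_iff)
  qed
  fix k
  have "L2_energy M (\<lambda>x. ?Z x - T k x)
      = (\<integral>\<^sup>+x. liminf (\<lambda>j. ennreal ((norm (T j x - T k x))\<^sup>2)) \<partial>M)"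
    unfolding L2_energy_def
  proof (rule nn_integral_cong_AE, use conv in eventually_elim)
    fix x assume "(\<lambda>k. T k x) \<longlonglongrightarrow> ?Z x"
    then have "(\<lambda>j. ennreal ((norm (T j x - T k x))\<^sup>2)) \<longlonglongrightarrow> ennreal ((norm (?Z x - T k x))\<^sup>2)"
      by (intro tendsto_ennrealI tendsto_intros)
    then show "ennreal ((norm (?Z x - T k x))\<^sup>2) = liminf (\<lambda>j. ennreal ((norm (T j x - T k x))\<^sup>2))"
      using lim_imp_Liminf[OF sequentially_bot] by metis
  qed
  also have "\<dots> \<le> liminf (\<lambda>j. L2_energy M (\<lambda>x. T j x - T k x))"
    unfolding L2_energy_def by (rule nn_integral_liminf) simp
  also have "\<dots> \<le> limsup (\<lambda>j. L2_energy M (\<lambda>x. T j x - T k x))"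
    by (rule Liminf_le_Limsup) simp
  also have "\<dots> \<le> ennreal ((1/4)^k)"
    by (intro Limsup_bounded eventually_sequentiallyI[of k] Cauchy)
  finally show "L2_energy M (\<lambda>x. ?Z x - T k x) \<le> ennreal ((1/4)^k)" .
qed

text \<open>Joins the two notions of sum in use: Fourier series are limits along finite subsets,
  whereas unfolding over tiles produces integrals against counting measure.\<close>

lemma nn_integral_count_space_has_sum:
  fixes f :: "'a \<Rightarrow> real"
  assumes "(f has_sum s) UNIV" "\<And>x. 0 \<le> f x"
  shows "(\<integral>\<^sup>+x. ennreal (f x) \<partial>count_space UNIV) = ennreal s"
proof -
  have "f summable_on UNIV"
    using assms(1) by (rule has_sum_imp_summable)
  then have int: "Infinite_Set_Sum.abs_summable_on f UNIV"
    using abs_summable_equivalent[of f UNIV] summable_on_iff_abs_summable_on_real[of f UNIV] by simp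
  then have "infsetsum f UNIV = s"
    using infsetsum_infsum[OF int] assms(1) by (simp add: infsumI)
  then show ?thesis
    using assms(2) int by (simp add: nn_integral_eq_integral infsetsum_def abs_summable_on_def)
qed

text \<open>Cauchy criterion for unordered sums: if \<open>K\<close> and all its finite enlargements
  are within e/2 of the total, anything added to \<open>K\<close> contributes less than e.\<close>

lemma count_space_tail:
  fixes f :: "'a \<Rightarrow> real"
  assumes "(\<integral>\<^sup>+x. ennreal (f x) \<partial>count_space UNIV) < \<infinity>" "\<And>x. 0 \<le> f x" "0 < e"
  obtains K where "finite K" "\<And>L. finite L \<Longrightarrow> L \<inter> K = {} \<Longrightarrow> sum f L < e"
proof -
  have "integrable (count_space UNIV) f"
    using assms by (simp add: integrable_iff_bounded)
  then have "f summable_on UNIV"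
    using abs_summable_equivalent[of f UNIV] summable_on_iff_abs_summable_on_real[of f UNIV]
    by (simp add: abs_summable_on_def)
  then obtain s where s: "(f has_sum s) UNIV"
    by (auto simp: summable_on_def)
  then have "\<forall>\<^sub>F L in finite_subsets_at_top UNIV. dist (sum f L) s < e / 2"
    using \<open>0 < e\<close> unfolding has_sum_def by (intro tendstoD) auto
  then obtain K where K: "finite K" "\<And>L. finite L \<Longrightarrow> K \<subseteq> L \<Longrightarrow> dist (sum f L) s < e / 2"
    unfolding eventually_finite_subsets_at_top by auto
  show thesis
  proof
    fix L :: "'a set" assume L: "finite L" "L \<inter> K = {}"
    have "dist (sum f (L \<union> K)) s < e / 2" "dist (sum f K) s < e / 2"
      using K L by auto
    moreover have "sum f (L \<union> K) = sum f L + sum f K"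
      using K L by (intro sum.union_disjoint) auto
    ultimately show "sum f L < e" unfolding dist_real_def by linarith
  qed (rule K)
qed

section \<open>Extension of characters\<close>

lemma dual_groupD:
  assumes "\<alpha> \<in> dual_group"
  shows dual_add: "\<alpha> (g + h) = \<alpha> g * \<alpha> h" and dual_norm: "norm (\<alpha> g) = 1"
  using assms by (auto simp: dual_group_def)

lemma dual_nonzero: "\<alpha> \<in> dual_group \<Longrightarrow> \<alpha> g \<noteq> 0"
  using dual_norm[of \<alpha> g] by auto

lemma dual_zero: "\<alpha> \<in> dual_group \<Longrightarrow> \<alpha> 0 = 1"
  using dual_add[of \<alpha> 0 0] dual_nonzero[of \<alpha> 0] by simp

lemma dual_minus: "\<alpha> \<in> dual_group \<Longrightarrow> \<alpha> (- g) = cnj (\<alpha> g)"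
proof -
  assume a: "\<alpha> \<in> dual_group"
  have "\<alpha> g * \<alpha> (- g) = 1"
    using dual_add[OF a, of g "- g"] dual_zero[OF a] by simp
  moreover have "\<alpha> g * cnj (\<alpha> g) = 1"
    by (simp add: dual_norm[OF a] flip: complex_norm_square)
  ultimately show ?thesis
    using dual_nonzero[OF a, of g] by (metis mult_left_cancel)
qed

text \<open>A partial character is encoded by its graph, a subgroup of \<open>\<Gamma> \<times> \<complex>\<close> whose second
  components have modulus one and which meets \<open>{0} \<times> \<complex>\<close> only in \<open>(0, 1)\<close>.\<close>

definition partial_character :: "('g::ab_group_add \<times> complex) set \<Rightarrow> bool" where
  "partial_character K \<longleftrightarrow> (0, 1) \<in> K \<and> (\<forall>g z. (g, z) \<in> K \<longrightarrow> norm z = 1 \<and> (- g, inverse z) \<in> K) \<and>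
     (\<forall>g z h w. (g, z) \<in> K \<longrightarrow> (h, w) \<in> K \<longrightarrow> (g + h, z * w) \<in> K) \<and> (\<forall>z. (0, z) \<in> K \<longrightarrow> z = 1)"

primrec nat_mult :: "nat \<Rightarrow> 'g::ab_group_add \<Rightarrow> 'g" where
  "nat_mult 0 g = 0"
| "nat_mult (Suc n) g = g + nat_mult n g"

text \<open>For each k at least one of the two terms vanishes. The difference form leads to
  \<open>int_mult_diff\<close>, which reduces additivity to that of natural multiples.\<close>

definition int_mult :: "int \<Rightarrow> 'g::ab_group_add \<Rightarrow> 'g" where
  "int_mult k g = nat_mult (nat k) g - nat_mult (nat (- k)) g"

lemma nat_mult_add: "nat_mult (m + n) g = nat_mult m g + nat_mult n g"
  by (induction m) (simp_all add: add.assoc)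

lemma int_mult_diff: "int_mult (int a - int b) g = nat_mult a g - nat_mult b g"
proof (cases "a \<le> b")
  case True
  then obtain c where "b = a + c" by (auto simp: le_iff_add)
  then show ?thesis by (simp add: int_mult_def nat_mult_add)
next
  case False
  then obtain c where "a = b + c" by (metis le_iff_add nat_le_linear)
  then show ?thesis by (simp add: int_mult_def nat_mult_add)
qed

lemma int_mult_add: "int_mult (k + l) g = int_mult k g + int_mult l g"
proof -
  obtain a b c d where "k = int a - int b" "l = int c - int d"
    by (metis int_diff_cases)
  moreover have "int a - int b + (int c - int d) = int (a + c) - int (b + d)" by simp
  ultimately show ?thesis
    by (simp only: int_mult_diff nat_mult_add) (simp add: algebra_simps)
qed

lemma int_mult_simps [simp]: "int_mult 0 g = 0" "int_mult 1 g = g"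
  by (simp_all add: int_mult_def)

lemma int_mult_minus: "int_mult (- k) g = - int_mult k g"
  by (simp add: int_mult_def)

lemma int_mult_mult: "int_mult (k * l) g = int_mult k (int_mult l g)"
proof (induction k rule: int_induct[where k = 0])
  case (step1 i)
  then show ?case by (simp add: distrib_right int_mult_add)
next
  case (step2 i)
  then show ?case
    using int_mult_add[of "(i - 1) * l" l g] int_mult_add[of "i - 1" 1 "int_mult l g"]
    by (simp add: algebra_simps)
qed simp

lemma partial_character_int_mult:
  assumes "partial_character K" "(g, z) \<in> K"
  shows "(int_mult k g, z powi k) \<in> K"
proof -
  have "norm z = 1" using assms unfolding partial_character_def by blast
  then have nz: "z \<noteq> 0" by auto
  show ?thesis
  proof (induction k rule: int_induct[where k = 0])
    case base
    then show ?case using assms by (simp add: partial_character_def)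
  next
    case (step1 i)
    then show ?case using assms nz
      unfolding partial_character_def by (simp add: int_mult_add power_int_add)
  next
    case (step2 i)
    have "(- g, inverse z) \<in> K" using assms by (simp add: partial_character_def)
    with step2 have "(int_mult i g + - g, z powi i * inverse z) \<in> K"
      using assms unfolding partial_character_def by blast
    moreover have "int_mult i g + - g = int_mult (i - 1) g"
      using int_mult_add[of "i - 1" 1 g] by simp
    ultimately show ?case using nz by (simp add: power_int_diff divide_inverse)
  qed
qed

text \<open>The value \<open>w\<close> at the new element must be compatible with the relations \<open>k x \<in> dom K\<close>; these
  integers \<open>k\<close> form a subgroup of \<open>\<int>\<close>, so it suffices to take a root at its generator.\<close>

lemma partial_character_extend_value:
  assumes K: "partial_character K"
  obtains w :: complex where "norm w = 1" "\<And>k z. (int_mult k x, z) \<in> K \<Longrightarrow> z = w powi k"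
    "x \<notin> fst ` K \<Longrightarrow> w \<noteq> 1"
proof (cases "\<exists>n>0. \<exists>z. (int_mult (int n) x, z) \<in> K")
  case True
  define n where "n = (LEAST n. n > 0 \<and> (\<exists>z. (int_mult (int n) x, z) \<in> K))"
  have n: "n > 0 \<and> (\<exists>z. (int_mult (int n) x, z) \<in> K)"
    unfolding n_def using True by (rule_tac LeastI_ex) auto
  have least: "\<not> (m > 0 \<and> (\<exists>z. (int_mult (int m) x, z) \<in> K))" if "m < n" for m
    using that unfolding n_def by (rule not_less_Least)
  from n obtain z0 where z0: "(int_mult (int n) x, z0) \<in> K" by auto
  then have norm_z0: "norm z0 = 1" using K by (auto simp: partial_character_def)
  define w1 where "w1 = cis (Arg z0 / real n)"
  have w1n: "w1 ^ n = z0"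
  proof -
    have "w1 ^ n = cis (Arg z0)" unfolding w1_def Complex.DeMoivre using n by auto
    also have "\<dots> = z0" using norm_z0 by (subst cis_Arg) (auto simp: sgn_div_norm)
    finally show ?thesis .
  qed
  \<comment> \<open>An n-th root of \<open>z0\<close> other than 1 is wanted. If \<open>w1\<close> =
    1 then \<open>z0\<close> = 1, and the root of unity with angle 2 pi / n serves as well.\<close>
  define w where "w = (if w1 = 1 then cis (2 * pi / n) else w1)"
  have wn: "w ^ n = z0"
    unfolding w_def using n w1n by (auto simp: Complex.DeMoivre)
  show thesis
  proof
    show "norm w = 1" by (simp add: w_def w1_def)
    show "w \<noteq> 1" if "x \<notin> fst ` K"
    proof -
      \<comment> \<open>For n = 1 the element x would itself lie in the domain. For n >= 2 the angle
        2 pi / n lies in (0, pi], where the cosine is below 1.\<close>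
      have "n \<noteq> 1" using that z0 by (auto simp: image_iff)
      with n have "n \<ge> 2" by linarith
      then have "cos (2 * pi / n) < 1"
        using cos_monotone_0_pi[of 0 "2 * pi / n"] by (simp add: field_simps)
      then have "cis (2 * pi / n) \<noteq> 1" by (auto simp: complex_eq_iff)
      then show ?thesis by (simp add: w_def)
    qed
    fix k z assume kz: "(int_mult k x, z) \<in> K"
    \<comment> \<open>Dividing out the relation at n exactly q times leaves
      \<open>int_mult r x\<close> in the domain with 0 <= r < n, so minimality of n forces r =
      0.\<close>
    define q r where "q = k div int n" and "r = k mod int n"
    have k: "k = q * int n + r" by (simp add: q_def r_def)
    have "(int_mult (- q) (int_mult (int n) x), z0 powi (- q)) \<in> K"
      by (rule partial_character_int_mult[OF K z0])
    then have *: "(int_mult k x + int_mult (- q * int n) x, z * z0 powi (- q)) \<in> K"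
      using K kz unfolding partial_character_def int_mult_mult by blast
    have "int_mult k x + int_mult (- q * int n) x = int_mult r x"
      by (simp add: k flip: int_mult_add)
    with * have r: "(int_mult r x, z * z0 powi (- q)) \<in> K" by simp
    have "r = int (nat r)" "nat r < n"
      using n by (auto simp: r_def nat_less_iff)
    with r least[of "nat r"] have "r = 0" by (metis neq0_conv of_nat_0)
    with r K have "z * z0 powi (- q) = 1" by (auto simp: partial_character_def)
    then have "z = z0 powi q" using norm_z0
      by (auto simp: power_int_minus field_simps)
    also have "\<dots> = w powi k"
      using power_int_mult[of w "int n" q] by (simp add: k \<open>r = 0\<close> wn mult.commute)
    finally show "z = w powi k" .
  qed
next
  case False
  show thesis
  proof
    \<comment> \<open>No nonzero multiple of x lies in the domain, so k = 0 is the only relation and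
      every unit value is compatible; -1 is taken because it differs from 1.\<close>
    fix k z assume kz: "(int_mult k x, z) \<in> K"
    then have "(int_mult (- k) x, inverse z) \<in> K"
      using K by (simp add: int_mult_minus partial_character_def)
    with kz False have "\<not> k > 0" "\<not> - k > 0"
      by (metis zero_less_imp_eq_int)+
    then have "k = 0" by simp
    with kz K show "z = (- 1) powi k" by (auto simp: partial_character_def)
  qed simp_all
qed

text \<open>\<open>K'\<close> is the subgroup generated by \<open>K\<close> and (x, w). It stays
  single-valued over 0 because w agrees with \<open>K\<close> at every multiple of x in its domain.
  The clause w \<noteq> 1 is kept for the separation of points.\<close>

lemma partial_character_extend:
  assumes K: "partial_character K"
  obtains K' w where "partial_character K'" "K \<subseteq> K'" "(x, w) \<in> K'" "x \<notin> fst ` K \<Longrightarrow> w \<noteq> 1"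
proof -
  obtain w :: complex where w: "norm w = 1" "\<And>k z. (int_mult k x, z) \<in> K \<Longrightarrow> z = w powi k"
    "x \<notin> fst ` K \<Longrightarrow> w \<noteq> 1"
    using partial_character_extend_value[OF K] by blast
  have w0: "w \<noteq> 0" using w by auto
  define K' where "K' = {(g + int_mult k x, z * w powi k) | g z k. (g, z) \<in> K}"
  have in_K': "(a, b) \<in> K'" if "(g, z) \<in> K" "a = g + int_mult k x" "b = z * w powi k" for a b g z k
    using that by (auto simp: K'_def)
  note K_facts = K[unfolded partial_character_def]
  have "partial_character K'"
    unfolding partial_character_def
  proof (intro conjI allI impI)
    show "(0, 1) \<in> K'" by (rule in_K'[of 0 1 _ 0]) (use K_facts in auto)
  next
    fix g z assume "(g, z) \<in> K'"
    then obtain h y k where *: "(h, y) \<in> K" "g = h + int_mult k x" "z = y * w powi k"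
      by (auto simp: K'_def)
    show "norm z = 1" using * K_facts w by (auto simp: norm_mult norm_power_int)
    show "(- g, inverse z) \<in> K'"
      by (rule in_K'[of "- h" "inverse y" _ "- k"])
        (use * K_facts in \<open>auto simp: int_mult_minus power_int_minus\<close>)
  next
    fix g z h y assume "(g, z) \<in> K'" "(h, y) \<in> K'"
    then obtain g' z' k h' y' l where *: "(g', z') \<in> K" "g = g' + int_mult k x" "z = z' * w powi k"
      "(h', y') \<in> K" "h = h' + int_mult l x" "y = y' * w powi l"
      by (auto simp: K'_def)
    show "(g + h, z * y) \<in> K'"
    proof (rule in_K'[of "g' + h'" "z' * y'" _ "k + l"])
      show "(g' + h', z' * y') \<in> K" using * K_facts by blast
    qed (use * w0 in \<open>auto simp: int_mult_add power_int_add algebra_simps\<close>)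
  next
    fix z assume "(0, z) \<in> K'"
    then obtain h y k where *: "(h, y) \<in> K" "0 = h + int_mult k x" "z = y * w powi k"
      by (auto simp: K'_def)
    have "h = int_mult (- k) x" using * by (simp add: int_mult_minus eq_neg_iff_add_eq_0)
    with * w(2)[of "- k" y] have "y = w powi (- k)" by simp
    with * w0 show "z = 1" by (simp add: power_int_minus)
  qed
  moreover have "K \<subseteq> K'"
  proof
    fix p assume "p \<in> K"
    then show "p \<in> K'" using in_K'[of "fst p" "snd p" "fst p" 0 "snd p"] by simp
  qed
  moreover have "(x, w) \<in> K'"
    by (rule in_K'[of 0 1 _ 1]) (use K_facts in auto)
  ultimately show thesis using that w(3) by blast
qed

lemma partial_character_functional:
  assumes K: "partial_character K" and "(g, z) \<in> K" "(g, w) \<in> K"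
  shows "z = w"
proof -
  have "(- g, inverse w) \<in> K" using assms by (simp add: partial_character_def)
  then have "(g + - g, z * inverse w) \<in> K"
    using K \<open>(g, z) \<in> K\<close> unfolding partial_character_def by blast
  then have "z * inverse w = 1" using K by (simp add: partial_character_def)
  then show ?thesis by (metis inverse_inverse_eq inverse_unique mult.commute)
qed

text \<open>Zorn's lemma on graphs ordered by inclusion. A maximal graph is defined everywhere,
  since \<open>partial_character_extend\<close> would enlarge it at a missing element.\<close>

lemma partial_character_total:
  assumes "partial_character K"
  obtains \<alpha> where "\<alpha> \<in> dual_group" "\<And>g z. (g, z) \<in> K \<Longrightarrow> \<alpha> g = z"
proof -
  let ?S = "{L. partial_character L \<and> K \<subseteq> L}"
  have "\<exists>U\<in>?S. \<forall>X\<in>c. X \<subseteq> U" if "subset.chain ?S c" for c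
  proof (cases "c = {}")
    case True
    then show ?thesis using assms by auto
  next
    case False
    have c: "\<And>X. X \<in> c \<Longrightarrow> partial_character X \<and> K \<subseteq> X"
      "\<And>X Y. X \<in> c \<Longrightarrow> Y \<in> c \<Longrightarrow> X \<subseteq> Y \<or> Y \<subseteq> X"
      using that unfolding subset.chain_def by blast+
    have "partial_character (\<Union>c)"
      unfolding partial_character_def
    proof (intro conjI allI impI)
      show "(0, 1) \<in> \<Union>c" using False c by (auto simp: partial_character_def)
    next
      fix g z assume "(g, z) \<in> \<Union>c"
      then obtain X where "X \<in> c" "(g, z) \<in> X" by blast
      with c(1)[of X] show "norm z = 1" "(- g, inverse z) \<in> \<Union>c"
        unfolding partial_character_def by blast+
    next
      fix g z h w assume "(g, z) \<in> \<Union>c" "(h, w) \<in> \<Union>c"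
      then obtain X where "X \<in> c" "(g, z) \<in> X" "(h, w) \<in> X"
        using c(2) by (elim UnionE) blast
      then show "(g + h, z * w) \<in> \<Union>c"
        using c(1)[of X] unfolding partial_character_def by blast
    next
      fix z assume "(0, z) \<in> \<Union>c"
      then show "z = 1" using c by (auto simp: partial_character_def)
    qed
    moreover have "K \<subseteq> \<Union>c" using False c by blast
    ultimately show ?thesis by blast
  qed
  then obtain L where L: "partial_character L" "K \<subseteq> L"
    and max: "\<And>X. partial_character X \<Longrightarrow> L \<subseteq> X \<Longrightarrow> X = L"
    using subset_Zorn[of ?S] by auto
  have total: "\<exists>z. (x, z) \<in> L" for x
  proof -
    obtain K' w where "partial_character K'" "L \<subseteq> K'" "(x, w) \<in> K'"
      using partial_character_extend[OF L(1)] by blast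
    with max[of K'] show ?thesis by blast
  qed
  define \<alpha> where "\<alpha> g = (SOME z. (g, z) \<in> L)" for g
  have \<alpha>: "(g, \<alpha> g) \<in> L" for g
    unfolding \<alpha>_def using total by (rule someI_ex)
  have eq: "\<alpha> g = z" if "(g, z) \<in> L" for g z
    using partial_character_functional[OF L(1) \<alpha> that] .
  show thesis
  proof
    show "\<alpha> \<in> dual_group"
      using \<alpha> L(1) by (auto simp: dual_group_def partial_character_def intro!: eq)
    show "\<alpha> g = z" if "(g, z) \<in> K" for g z
      using that L(2) by (auto intro: eq)
  qed
qed

text \<open>The trivial graph {(0, 1)} omits g, so the one-step extension takes a value other than 1
  at g and a total extension keeps it. This is what makes evaluation at g integrate to zero.\<close>

lemma dual_group_separates:
  fixes g :: "'g::ab_group_add"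
  assumes "g \<noteq> 0"
  obtains \<alpha> where "\<alpha> \<in> dual_group" "\<alpha> g \<noteq> 1"
proof -
  have "partial_character {(0::'g, 1::complex)}" by (simp add: partial_character_def)
  then obtain K w where K: "partial_character K" "(g, w) \<in> K" "w \<noteq> 1"
    using partial_character_extend[of "{(0, 1)}" g] assms by simp blast
  obtain \<alpha> where "\<alpha> \<in> dual_group" "\<And>h z. (h, z) \<in> K \<Longrightarrow> \<alpha> h = z"
    using partial_character_total[OF K(1)] by blast
  with K that show thesis by metis
qed

section \<open>Haar measure on the dual group\<close>

lemma closed_dual_group: "closed (dual_group :: ('g::{ab_group_add,countable} \<Rightarrow> complex) set)"
proof -
  have eq: "dual_group = (\<Inter>g. \<Inter>h. {\<alpha> :: 'g \<Rightarrow> complex. \<alpha> (g + h) = \<alpha> g * \<alpha> h}) \<inter> (\<Inter>g. {\<alpha>. norm (\<alpha> g) = 1})"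
    by (auto simp: dual_group_def)
  show ?thesis
    unfolding eq
    by (intro closed_Int closed_INT ballI closed_Collect_eq continuous_intros continuous_on_product_coordinates)
qed

text \<open>Tychonoff's theorem: the dual is a closed subset of a product of circles. Compactness is
  what Stone-Weierstrass asks for.\<close>

lemma compact_dual_group: "compact (dual_group :: ('g::{ab_group_add,countable} \<Rightarrow> complex) set)"
proof -
  have "compactin (product_topology (\<lambda>_::'g. euclidean) UNIV) (\<Pi>\<^sub>E i\<in>UNIV. sphere (0::complex) 1)"
    by (subst compactin_PiE) (auto simp: compactin_euclidean_iff)
  then have "compact (\<Pi>\<^sub>E i\<in>(UNIV::'g set). sphere (0::complex) 1)"
    by (simp add: euclidean_product_topology compactin_euclidean_iff)
  then have "compact ((\<Pi>\<^sub>E i\<in>(UNIV::'g set). sphere (0::complex) 1) \<inter> dual_group)"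
    using closed_dual_group by (rule compact_Int_closed)
  moreover have "dual_group \<subseteq> (\<Pi>\<^sub>E i\<in>(UNIV::'g set). sphere (0::complex) 1)"
    by (auto simp: dual_norm)
  ultimately show ?thesis by (simp add: Int_absorb1)
qed

text \<open>Real-valued, because the real form of Stone-Weierstrass is applied; the coefficients
  remain complex, and values off \<open>dual_group\<close> are left free.\<close>

definition trig_poly :: "(('g::ab_group_add \<Rightarrow> complex) \<Rightarrow> real) \<Rightarrow> bool" where
  "trig_poly f \<longleftrightarrow> (\<exists>K b. finite K \<and> (\<forall>\<alpha>\<in>dual_group. complex_of_real (f \<alpha>) = (\<Sum>\<gamma>\<in>K. b \<gamma> * \<alpha> \<gamma>)))"

text \<open>Terms with equal exponents are collected. Repeated exponents are thereby allowed, so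
  sums and products can be indexed by disjoint unions and Cartesian products.\<close>

lemma trig_polyI:
  fixes f :: "('g::ab_group_add \<Rightarrow> complex) \<Rightarrow> real"
  assumes "finite F" "\<And>\<alpha>. \<alpha> \<in> dual_group \<Longrightarrow> complex_of_real (f \<alpha>) = (\<Sum>i\<in>F. b i * \<alpha> (g i))"
  shows "trig_poly f"
  unfolding trig_poly_def
proof (intro exI conjI ballI)
  fix \<alpha> :: "'g \<Rightarrow> complex" assume "\<alpha> \<in> dual_group"
  then have "complex_of_real (f \<alpha>) = (\<Sum>i\<in>F. b i * \<alpha> (g i))" by (rule assms)
  also have "\<dots> = (\<Sum>\<gamma>\<in>g ` F. \<Sum>i\<in>{i\<in>F. g i = \<gamma>}. b i * \<alpha> (g i))"
    using assms(1) by (rule sum.image_gen)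
  also have "\<dots> = (\<Sum>\<gamma>\<in>g ` F. (\<Sum>i\<in>{i\<in>F. g i = \<gamma>}. b i) * \<alpha> \<gamma>)"
    unfolding sum_distrib_right by (intro sum.cong) auto
  finally show "complex_of_real (f \<alpha>) = \<dots>" .
qed (use assms in simp)

lemma trig_poly_continuous:
  assumes "trig_poly (f :: ('g::{ab_group_add,countable} \<Rightarrow> complex) \<Rightarrow> real)"
  shows "continuous_on dual_group f"
proof -
  obtain K b where K: "\<And>\<alpha>. \<alpha> \<in> dual_group \<Longrightarrow> complex_of_real (f \<alpha>) = (\<Sum>\<gamma>\<in>K. b \<gamma> * \<alpha> \<gamma>)"
    using assms by (auto simp: trig_poly_def)
  have "continuous_on dual_group (\<lambda>\<alpha>. Re (\<Sum>\<gamma>\<in>K. b \<gamma> * \<alpha> \<gamma>))"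
    by (intro continuous_intros continuous_on_subset[OF continuous_on_product_coordinates]) auto
  then show ?thesis
    by (rule continuous_on_eq) (simp flip: K)
qed

text \<open>Stone-Weierstrass. Two distinct points of the dual differ at some coordinate g, hence in
  the real or imaginary part of evaluation at g; both parts are trigonometric polynomials because
  conjugation replaces g by -g.\<close>

lemma trig_poly_dense:
  fixes f :: "('g::{ab_group_add,countable} \<Rightarrow> complex) \<Rightarrow> real"
  assumes "continuous_on dual_group f" "0 < e"
  shows "\<exists>p. trig_poly p \<and> (\<forall>\<alpha>\<in>dual_group. \<bar>f \<alpha> - p \<alpha>\<bar> < e)"
proof (rule Stone_Weierstrass_HOL[OF compact_dual_group _ _ _ _ _ assms])
  show "trig_poly (\<lambda>x::'g \<Rightarrow> complex. c)" for c
    by (rule trig_polyI[of "{0::'g}" _ "\<lambda>_. of_real c" "\<lambda>g. g"]) (simp_all add: dual_zero)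
  show "continuous_on dual_group p" if "trig_poly p" for p :: "('g \<Rightarrow> complex) \<Rightarrow> real"
    using that by (rule trig_poly_continuous)
  show "trig_poly (\<lambda>x. p x + q x)" if pq: "trig_poly p \<and> trig_poly q"
    for p q :: "('g \<Rightarrow> complex) \<Rightarrow> real"
  proof -
    obtain K b L c where *: "finite K" "\<And>\<alpha>. \<alpha> \<in> dual_group \<Longrightarrow> complex_of_real (p \<alpha>) = (\<Sum>\<gamma>\<in>K. b \<gamma> * \<alpha> \<gamma>)"
      "finite L" "\<And>\<alpha>. \<alpha> \<in> dual_group \<Longrightarrow> complex_of_real (q \<alpha>) = (\<Sum>\<gamma>\<in>L. c \<gamma> * \<alpha> \<gamma>)"
      using pq unfolding trig_poly_def by metis
    show ?thesis
      by (rule trig_polyI[of "K <+> L" _ "case_sum b c" "case_sum id id"]) (use * in \<open>auto simp: sum.Plus\<close>)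
  qed
  show "trig_poly (\<lambda>x. p x * q x)" if pq: "trig_poly p \<and> trig_poly q"
    for p q :: "('g \<Rightarrow> complex) \<Rightarrow> real"
  proof -
    obtain K b L c where *: "finite K" "\<And>\<alpha>. \<alpha> \<in> dual_group \<Longrightarrow> complex_of_real (p \<alpha>) = (\<Sum>\<gamma>\<in>K. b \<gamma> * \<alpha> \<gamma>)"
      "finite L" "\<And>\<alpha>. \<alpha> \<in> dual_group \<Longrightarrow> complex_of_real (q \<alpha>) = (\<Sum>\<gamma>\<in>L. c \<gamma> * \<alpha> \<gamma>)"
      using pq unfolding trig_poly_def by metis
    show ?thesis
      by (rule trig_polyI[of "K \<times> L" _ "\<lambda>(i, j). b i * c j" "\<lambda>(i, j). i + j"])
        (use * in \<open>auto simp: sum_product sum.cartesian_product dual_add intro!: sum.cong\<close>)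
  qed
  show "\<exists>p. trig_poly p \<and> p \<alpha> \<noteq> p \<beta>" if ab: "\<alpha> \<in> dual_group \<and> \<beta> \<in> dual_group \<and> \<alpha> \<noteq> \<beta>"
    for \<alpha> \<beta> :: "'g \<Rightarrow> complex"
  proof -
    obtain g where g: "\<alpha> g \<noteq> \<beta> g" using ab by auto
    have "trig_poly (\<lambda>\<alpha>. Re (\<alpha> g))"
      by (rule trig_polyI[of "{True, False}" _ "\<lambda>_. 1/2" "\<lambda>b. if b then g else - g"])
        (simp_all add: dual_minus complex_eq_iff)
    moreover have "trig_poly (\<lambda>\<alpha>. Im (\<alpha> g))"
      \<comment> \<open>The coefficients express Im z = (z - cnj z) / (2 i), with cnj (\<alpha> g) =
        \<alpha> (- g).\<close>
      by (rule trig_polyI[of "{True, False}" _ "\<lambda>b. if b then - \<i> / 2 else \<i> / 2" "\<lambda>b. if b then g else - g"])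
        (simp_all add: dual_minus complex_eq_iff)
    ultimately show ?thesis using g by (metis complex_eqI)
  qed
qed

section \<open>Orthonormality of characters and positivity of functions on the dual group\<close>

locale haar =
  fixes m :: "('g::{ab_group_add,countable} \<Rightarrow> complex) measure"
  assumes normalized_haar: "normalized_haar m"
begin

lemma sets_haar: "sets m = sets (restrict_space borel dual_group)"
  using normalized_haar by (simp add: normalized_haar_def)

lemma space_haar: "space m = dual_group"
  using sets_eq_imp_space_eq[OF sets_haar] by (simp add: space_restrict_space)

lemma emeasure_space_haar: "emeasure m (space m) = 1"
  using normalized_haar by (simp add: normalized_haar_def space_haar)

sublocale finite_measure m
  by (rule finite_measureI) (simp add: emeasure_space_haar)

lemma measurable_haar: "f \<in> borel_measurable borel \<Longrightarrow> f \<in> borel_measurable m"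
  by (simp add: measurable_cong_sets[OF sets_haar refl] measurable_restrict_space1)

lemma measurable_eval [measurable]: "(\<lambda>\<alpha>. \<alpha> g) \<in> borel_measurable m"
  by (rule measurable_haar) (rule measurable_product_coordinates)

text \<open>Invariance is assumed for images, while push-forward looks at preimages: the preimage
  under translation by \<beta> is the image under translation by the conjugate character, which is
  \<open>?S\<close>.\<close>

lemma distr_translate:
  assumes \<beta>: "\<beta> \<in> dual_group"
  shows "(\<lambda>\<alpha> \<gamma>. \<beta> \<gamma> * \<alpha> \<gamma>) \<in> measurable m m" "distr m m (\<lambda>\<alpha> \<gamma>. \<beta> \<gamma> * \<alpha> \<gamma>) = m"
proof -
  let ?T = "\<lambda>\<alpha> \<gamma>. \<beta> \<gamma> * \<alpha> \<gamma>" and ?S = "\<lambda>\<alpha> \<gamma>. cnj (\<beta> \<gamma>) * \<alpha> \<gamma>"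
  have cb: "(\<lambda>\<gamma>. cnj (\<beta> \<gamma>)) \<in> dual_group"
    using \<beta> by (auto simp: dual_group_def)
  have T: "?T \<alpha> \<in> dual_group" and S: "?S \<alpha> \<in> dual_group" if "\<alpha> \<in> dual_group" for \<alpha>
    using that \<beta> by (auto simp: dual_group_def norm_mult)
  have one: "\<beta> \<gamma> * cnj (\<beta> \<gamma>) = 1" for \<gamma>
    by (simp add: dual_norm[OF \<beta>] flip: complex_norm_square)
  have TS: "?T (?S \<alpha>) = \<alpha>" "?S (?T \<alpha>) = \<alpha>" for \<alpha>
    using one by (simp_all add: mult.assoc[symmetric] mult.commute[of "cnj (\<beta> _)" "\<beta> _"])
  have "?T \<in> borel_measurable m"
    by (intro measurable_coordinatewise_then_product) measurable
  then have "?T \<in> measurable m (restrict_space borel dual_group)"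
    by (intro measurable_restrict_space2) (auto simp: space_haar T)
  then show meas: "?T \<in> measurable m m"
    by (simp add: measurable_cong_sets[OF refl sets_haar])
  show "distr m m ?T = m"
  proof (rule measure_eqI)
    fix E assume E: "E \<in> sets (distr m m ?T)"
    then have sub: "E \<subseteq> dual_group" using sets.sets_into_space[of E m] by (simp add: space_haar)
    have "?T -` E \<inter> space m = ?S ` E"
    proof (intro equalityI subsetI)
      fix \<alpha> assume "\<alpha> \<in> ?T -` E \<inter> space m"
      then have "?T \<alpha> \<in> E" "\<alpha> = ?S (?T \<alpha>)" by (simp_all only: TS) auto
      then show "\<alpha> \<in> ?S ` E" by (intro image_eqI[of _ ?S "?T \<alpha>"])
    next
      fix \<alpha> assume "\<alpha> \<in> ?S ` E"
      then obtain \<epsilon> where "\<epsilon> \<in> E" "\<alpha> = ?S \<epsilon>" by auto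
      then show "\<alpha> \<in> ?T -` E \<inter> space m"
        using S[of \<epsilon>] TS(1)[of \<epsilon>] sub by (auto simp: space_haar)
    qed
    then show "emeasure (distr m m ?T) E = emeasure m E"
      using E cb normalized_haar by (simp add: emeasure_distr[OF meas] normalized_haar_def)
  qed simp
qed

lemma integrable_eval: "integrable m (\<lambda>\<alpha>. \<alpha> g)"
  by (rule integrable_const_bound[where B = 1]) (auto simp: space_haar dual_norm)

text \<open>For g \<noteq> 0, translating by a character \<beta> with \<beta> g \<noteq> 1
  multiplies the integral by \<beta> g without changing it, so it vanishes.\<close>

lemma integral_eval: "(\<integral>\<alpha>. \<alpha> g \<partial>m) = (if g = 0 then 1 else 0)"
proof (cases "g = 0")
  case True
  have "(\<integral>\<alpha>. \<alpha> g \<partial>m) = (\<integral>\<alpha>. 1 \<partial>m)"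
    by (rule Bochner_Integration.integral_cong) (auto simp: space_haar True dual_zero)
  then show ?thesis using True by (simp add: measure_def emeasure_space_haar)
next
  case False
  obtain \<beta> where \<beta>: "\<beta> \<in> dual_group" "\<beta> g \<noteq> 1"
    using dual_group_separates[OF False] .
  have "(\<integral>\<alpha>. \<alpha> g \<partial>m) = (\<integral>\<alpha>. \<alpha> g \<partial>distr m m (\<lambda>\<alpha> \<gamma>. \<beta> \<gamma> * \<alpha> \<gamma>))"
    by (simp add: distr_translate \<beta>)
  also have "\<dots> = (\<integral>\<alpha>. \<beta> g * \<alpha> g \<partial>m)"
    using distr_translate(1)[OF \<beta>(1)] by (subst integral_distr) auto
  finally show ?thesis using \<beta> False by simp
qed

lemma char_sum_in_L2: "(\<lambda>\<alpha>. \<Sum>i\<in>F. b i * \<alpha> (g i)) \<in> L2 m"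
proof (rule L2_sum_scale)
  show "(\<lambda>\<alpha>. \<alpha> (g i)) \<in> L2 m" for i
    unfolding L2_def by (auto intro!: integrable_const_bound[where B = 1] simp: space_haar dual_norm)
qed

text \<open>Expand the square and integrate term by term. Injectivity of g makes the characters of
  distinct indices distinct, so all off-diagonal terms vanish.\<close>

lemma char_sum_energy:
  assumes "finite F" "inj_on g F"
  shows "L2_energy m (\<lambda>\<alpha>. \<Sum>i\<in>F. b i * \<alpha> (g i)) = ennreal (\<Sum>i\<in>F. (norm (b i))\<^sup>2)"
proof -
  let ?p = "\<lambda>\<alpha>. \<Sum>i\<in>F. b i * \<alpha> (g i)"
  have sq: "complex_of_real ((norm (?p \<alpha>))\<^sup>2) = (\<Sum>i\<in>F. \<Sum>j\<in>F. (b i * cnj (b j)) * \<alpha> (g i - g j))"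
    if "\<alpha> \<in> space m" for \<alpha>
  proof -
    have "complex_of_real ((norm (?p \<alpha>))\<^sup>2) = ?p \<alpha> * cnj (?p \<alpha>)"
      by (rule complex_norm_square)
    also have "\<dots> = (\<Sum>i\<in>F. \<Sum>j\<in>F. (b i * \<alpha> (g i)) * (cnj (b j) * cnj (\<alpha> (g j))))"
      by (simp add: sum_product)
    also have "\<dots> = (\<Sum>i\<in>F. \<Sum>j\<in>F. (b i * cnj (b j)) * \<alpha> (g i - g j))"
    proof (intro sum.cong refl)
      fix i j
      have "\<alpha> (g i - g j) = \<alpha> (g i) * cnj (\<alpha> (g j))"
        using that dual_add[of \<alpha> "g i" "- g j"] by (simp add: space_haar dual_minus)
      then show "(b i * \<alpha> (g i)) * (cnj (b j) * cnj (\<alpha> (g j))) = (b i * cnj (b j)) * \<alpha> (g i - g j)"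
        by (simp only: mult_ac)
    qed
    finally show ?thesis .
  qed
  have "complex_of_real (\<integral>\<alpha>. (norm (?p \<alpha>))\<^sup>2 \<partial>m) = (\<integral>\<alpha>. complex_of_real ((norm (?p \<alpha>))\<^sup>2) \<partial>m)"
    by (rule integral_complex_of_real[symmetric])
  also have "\<dots> = (\<integral>\<alpha>. (\<Sum>i\<in>F. \<Sum>j\<in>F. (b i * cnj (b j)) * \<alpha> (g i - g j)) \<partial>m)"
    by (rule Bochner_Integration.integral_cong) (use sq in auto)
  also have "\<dots> = (\<Sum>i\<in>F. \<Sum>j\<in>F. (b i * cnj (b j)) * (if g i - g j = 0 then 1 else 0))"
    by (simp add: integrable_eval integral_eval)
  also have "\<dots> = (\<Sum>i\<in>F. \<Sum>j\<in>F. if i = j then b i * cnj (b j) else 0)"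
    using assms(2) by (intro sum.cong refl) (auto simp: inj_on_def)
  also have "\<dots> = (\<Sum>i\<in>F. complex_of_real ((norm (b i))\<^sup>2))"
    unfolding complex_norm_square using assms(1) by simp
  finally have "(\<integral>\<alpha>. (norm (?p \<alpha>))\<^sup>2 \<partial>m) = (\<Sum>i\<in>F. (norm (b i))\<^sup>2)"
    unfolding of_real_sum[symmetric] of_real_eq_iff .
  then show ?thesis
    using L2_energy_eq[OF char_sum_in_L2[of b g F]] by (simp add: L2_norm_def sum_nonneg)
qed

text \<open>The hypothesis speaks only of weights |p|^2. Approximating sqrt f uniformly by real
  trigonometric polynomials \<open>p n\<close> makes the admissible weights (p n)^2 converge to f,
  boundedly enough for dominated convergence.\<close>

lemma integral_continuous_nonneg:
  fixes h :: "('g \<Rightarrow> complex) \<Rightarrow> real"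
  assumes h: "integrable m h"
    and pos: "\<And>K b. finite K \<Longrightarrow> 0 \<le> (\<integral>\<alpha>. (norm (\<Sum>\<gamma>\<in>K. b \<gamma> * \<alpha> \<gamma>))\<^sup>2 * h \<alpha> \<partial>m)"
    and f: "continuous_on UNIV f" "\<And>\<alpha>. 0 \<le> f \<alpha>" "\<And>\<alpha>. f \<alpha> \<le> 1"
  shows "0 \<le> (\<integral>\<alpha>. f \<alpha> * h \<alpha> \<partial>m)"
proof -
  have [measurable]: "h \<in> borel_measurable m" using h by simp
  have "continuous_on dual_group (\<lambda>\<alpha>. sqrt (f \<alpha>))"
    by (intro continuous_intros continuous_on_subset[OF f(1)]) auto
  then have "\<exists>p. trig_poly p \<and> (\<forall>\<alpha>\<in>dual_group. \<bar>sqrt (f \<alpha>) - p \<alpha>\<bar> < inverse (real (Suc n)))" for n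
    by (rule trig_poly_dense) simp
  then obtain p where p: "\<And>n. trig_poly (p n)"
    "\<And>n \<alpha>. \<alpha> \<in> dual_group \<Longrightarrow> \<bar>sqrt (f \<alpha>) - p n \<alpha>\<bar> < inverse (real (Suc n))"
    by metis
  have [measurable]: "f \<in> borel_measurable m"
    using f by (intro measurable_haar borel_measurable_continuous_onI)
  have pint: "0 \<le> (\<integral>\<alpha>. (p n \<alpha>)\<^sup>2 * h \<alpha> \<partial>m)" and [measurable]: "p n \<in> borel_measurable m" for n
  proof -
    obtain K b where K: "finite K" "\<And>\<alpha>. \<alpha> \<in> dual_group \<Longrightarrow> complex_of_real (p n \<alpha>) = (\<Sum>\<gamma>\<in>K. b \<gamma> * \<alpha> \<gamma>)"
      using p(1)[of n] by (auto simp: trig_poly_def)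
    have "(\<integral>\<alpha>. (p n \<alpha>)\<^sup>2 * h \<alpha> \<partial>m) = (\<integral>\<alpha>. (norm (\<Sum>\<gamma>\<in>K. b \<gamma> * \<alpha> \<gamma>))\<^sup>2 * h \<alpha> \<partial>m)"
      by (rule Bochner_Integration.integral_cong) (auto simp: space_haar simp flip: K(2))
    then show "0 \<le> (\<integral>\<alpha>. (p n \<alpha>)\<^sup>2 * h \<alpha> \<partial>m)" using pos[OF K(1)] by simp
    have "(\<lambda>\<alpha>. Re (\<Sum>\<gamma>\<in>K. b \<gamma> * \<alpha> \<gamma>)) \<in> borel_measurable m" by measurable
    then show "p n \<in> borel_measurable m"
      by (rule measurable_cong[THEN iffD1, rotated]) (simp add: space_haar flip: K(2))
  qed
  have "(\<lambda>n. \<integral>\<alpha>. (p n \<alpha>)\<^sup>2 * h \<alpha> \<partial>m) \<longlonglongrightarrow> (\<integral>\<alpha>. f \<alpha> * h \<alpha> \<partial>m)"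
  proof (rule integral_dominated_convergence[where w = "\<lambda>\<alpha>. 4 * \<bar>h \<alpha>\<bar>"])
    show "integrable m (\<lambda>\<alpha>. 4 * \<bar>h \<alpha>\<bar>)" using h by auto
    show "AE \<alpha> in m. (\<lambda>n. (p n \<alpha>)\<^sup>2 * h \<alpha>) \<longlonglongrightarrow> f \<alpha> * h \<alpha>"
    proof (rule AE_I2)
      fix \<alpha> assume "\<alpha> \<in> space m"
      then have "(\<lambda>n. p n \<alpha>) \<longlonglongrightarrow> sqrt (f \<alpha>)"
        using p(2)[of \<alpha>] by (intro LIMSEQ_norm_0[THEN Lim_null[THEN iffD2]])
          (auto simp: space_haar real_norm_def inverse_eq_divide abs_minus_commute)
      then have "(\<lambda>n. (p n \<alpha>)\<^sup>2 * h \<alpha>) \<longlonglongrightarrow> (sqrt (f \<alpha>))\<^sup>2 * h \<alpha>"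
        by (intro tendsto_intros)
      then show "(\<lambda>n. (p n \<alpha>)\<^sup>2 * h \<alpha>) \<longlonglongrightarrow> f \<alpha> * h \<alpha>" using f by simp
    qed
    fix n show "AE \<alpha> in m. norm ((p n \<alpha>)\<^sup>2 * h \<alpha>) \<le> 4 * \<bar>h \<alpha>\<bar>"
    proof (rule AE_I2)
      fix \<alpha> assume "\<alpha> \<in> space m"
      then have "\<bar>sqrt (f \<alpha>) - p n \<alpha>\<bar> < inverse (real (Suc n))"
        using p(2) by (simp only: space_haar)
      also have "\<dots> \<le> 1" by (simp add: field_simps)
      finally have "\<bar>sqrt (f \<alpha>) - p n \<alpha>\<bar> < 1" .
      moreover have "0 \<le> sqrt (f \<alpha>)" "sqrt (f \<alpha>) \<le> 1" using f by auto
      \<comment> \<open>Origin of the dominating constant 4: sqrt f lies in [0, 1] and the error is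
        below 1, so |p n| <= 2.\<close>
      ultimately have "\<bar>p n \<alpha>\<bar> \<le> 2" by linarith
      then have "(p n \<alpha>)\<^sup>2 \<le> 4" using power_mono[of "\<bar>p n \<alpha>\<bar>" 2 2] by simp
      then show "norm ((p n \<alpha>)\<^sup>2 * h \<alpha>) \<le> 4 * \<bar>h \<alpha>\<bar>"
        by (simp add: abs_mult mult_right_mono)
    qed
  qed simp_all
  then show ?thesis
    by (rule LIMSEQ_le_const) (use pint in auto)
qed

text \<open>If h were negative on a set \<open>E\<close> of positive measure, \<open>E\<close> would
  contain a compact \<open>K\<close> of positive measure. Continuous weights converging to its
  indicator show that the integral of h over \<open>K\<close> is at least 0, which is
  impossible.\<close>

lemma AE_nonneg_of_char_sums:
  fixes h :: "('g \<Rightarrow> complex) \<Rightarrow> real"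
  assumes h: "integrable m h"
    and pos: "\<And>K b. finite K \<Longrightarrow> 0 \<le> (\<integral>\<alpha>. (norm (\<Sum>\<gamma>\<in>K. b \<gamma> * \<alpha> \<gamma>))\<^sup>2 * h \<alpha> \<partial>m)"
  shows "AE \<alpha> in m. 0 \<le> h \<alpha>"
proof (rule ccontr)
  assume neg: "\<not> (AE \<alpha> in m. 0 \<le> h \<alpha>)"
  have [measurable]: "h \<in> borel_measurable m" using h by simp
  define E where "E = {\<alpha>\<in>space m. \<not> 0 \<le> h \<alpha>}"
  have E: "E \<in> sets m" unfolding E_def by measurable
  have dg: "dual_group \<inter> space (borel :: ('g \<Rightarrow> complex) measure) \<in> sets borel"
    by (simp add: closed_dual_group borel_closed)
  have sets_m: "X \<in> sets m \<longleftrightarrow> X \<subseteq> dual_group \<and> X \<in> sets borel" for X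
    unfolding sets_haar using sets_restrict_space_iff[OF dg] by simp
  \<comment> \<open>Inner regularity is a theorem about Borel measures on the whole function space,
    so m is pushed forward along the inclusion of the dual group.\<close>
  let ?\<mu> = "distr m borel (\<lambda>\<alpha>. \<alpha>)"
  have id: "(\<lambda>\<alpha>. \<alpha>) \<in> measurable m borel"
    by (rule measurable_haar) simp
  have \<mu>: "emeasure ?\<mu> X = emeasure m X" if "X \<in> sets m" for X
    using that id by (auto simp: emeasure_distr sets_m space_haar intro!: arg_cong[where f = "emeasure m"])
  have "emeasure m E \<noteq> 0"
    using neg E by (auto simp: AE_iff_measurable[OF E] E_def)
  moreover have "emeasure ?\<mu> E = (SUP K \<in> {K. K \<subseteq> E \<and> compact K}. emeasure ?\<mu> K)"
    using E by (intro inner_regular) (auto simp: sets_m emeasure_distr id space_haar)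
  ultimately have "(SUP K \<in> {K. K \<subseteq> E \<and> compact K}. emeasure ?\<mu> K) \<noteq> 0"
    using \<mu>[OF E] by simp
  then obtain K where K: "K \<subseteq> E" "compact K" "emeasure ?\<mu> K \<noteq> 0"
    by (metis (no_types, lifting) SUP_bot_conv(2) bot_ennreal mem_Collect_eq)
  have Km [measurable]: "K \<in> sets m"
    using K E by (auto simp: sets_m borel_compact)
  have K0: "emeasure m K \<noteq> 0" "K \<noteq> {}" using \<mu>[OF Km] K by auto
  \<comment> \<open>Equal to 1 on \<open>K\<close> and, for n > 0, equal to 0 at distance at least
    1/n from it; these weights decrease to the indicator because \<open>K\<close> is closed.\<close>
  define f where "f n \<alpha> = max 0 (1 - real n * infdist \<alpha> K)" for n \<alpha>
  have f: "continuous_on UNIV (f n)" "0 \<le> f n \<alpha>" "f n \<alpha> \<le> 1" for n \<alpha>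
    unfolding f_def by (auto intro!: continuous_intros simp: infdist_nonneg)
  have [measurable]: "f n \<in> borel_measurable m" for n
    using f by (intro measurable_haar borel_measurable_continuous_onI)
  have "(\<lambda>n. \<integral>\<alpha>. f n \<alpha> * h \<alpha> \<partial>m) \<longlonglongrightarrow> (\<integral>\<alpha>. indicator K \<alpha> * h \<alpha> \<partial>m)"
  proof (rule integral_dominated_convergence[where w = "\<lambda>\<alpha>. \<bar>h \<alpha>\<bar>"])
    show "AE \<alpha> in m. (\<lambda>n. f n \<alpha> * h \<alpha>) \<longlonglongrightarrow> indicator K \<alpha> * h \<alpha>"
    proof (intro AE_I2 tendsto_intros)
      fix \<alpha>
      show "(\<lambda>n. f n \<alpha>) \<longlonglongrightarrow> indicator K \<alpha>"
      proof (cases "\<alpha> \<in> K")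
        case True
        then show ?thesis by (simp add: f_def)
      next
        case False
        then have "infdist \<alpha> K > 0"
          using K K0 in_closed_iff_infdist_zero[of K \<alpha>] compact_imp_closed infdist_nonneg[of \<alpha> K]
          by (metis less_eq_real_def)
        then obtain N where N: "1 < real N * infdist \<alpha> K"
          using reals_Archimedean3 by blast
        have "f n \<alpha> = 0" if "n \<ge> N" for n
        proof -
          have "real N * infdist \<alpha> K \<le> real n * infdist \<alpha> K"
            using that infdist_nonneg by (intro mult_right_mono) auto
          with N show ?thesis by (simp add: f_def)
        qed
        then show ?thesis
          using False by (intro tendsto_eventually eventually_sequentiallyI[of N]) auto
      qed
    qed
    show "AE \<alpha> in m. norm (f n \<alpha> * h \<alpha>) \<le> \<bar>h \<alpha>\<bar>" for n
      using f by (intro AE_I2) (simp add: abs_mult mult_left_le_one_le)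
  qed (use h in auto)
  then have ge: "0 \<le> (\<integral>\<alpha>. indicator K \<alpha> * h \<alpha> \<partial>m)"
    by (rule LIMSEQ_le_const) (use integral_continuous_nonneg[OF h pos f] in auto)
  \<comment> \<open>The integrand is strictly negative on \<open>K\<close>, so an integral that is
    at least 0 can only be 0, and then \<open>K\<close> is null.\<close>
  have int: "integrable m (\<lambda>\<alpha>. - (indicator K \<alpha> * h \<alpha>))"
    using integrable_mult_indicator[OF Km h] by simp
  have nn: "AE \<alpha> in m. 0 \<le> - (indicator K \<alpha> * h \<alpha>)"
    using K(1) by (intro AE_I2) (auto simp: indicator_def E_def)
  have "(\<integral>\<alpha>. - (indicator K \<alpha> * h \<alpha>) \<partial>m) = 0"
    using ge integral_nonneg_AE[OF nn] by simp
  then have "AE \<alpha> in m. - (indicator K \<alpha> * h \<alpha>) = 0"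
    using integral_nonneg_eq_0_iff_AE[OF int nn] by simp
  then have "AE \<alpha> in m. \<alpha> \<notin> K"
    by eventually_elim (use K(1) in \<open>auto simp: E_def indicator_def\<close>)
  then have "emeasure m K = 0"
    using AE_iff_measurable[OF Km, of "\<lambda>\<alpha>. \<alpha> \<notin> K"] K(1) by (auto simp: E_def)
  with K0 show False by simp
qed

end

section \<open>Jacobians and tilings\<close>

locale jacobian_action = sigma_finite_measure M
  for M :: "'x measure" +
  fixes \<sigma> :: "'g::{ab_group_add,countable} \<Rightarrow> 'x \<Rightarrow> 'x" and J :: "'g \<Rightarrow> 'x \<Rightarrow> real"
  assumes action: "measurable_action M \<sigma>" and jacobian: "is_jacobian M \<sigma> J"
begin

lemma action_measurable [measurable]: "\<sigma> \<gamma> \<in> measurable M M"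
  using action by (simp add: measurable_action_def)

lemma action_space: "x \<in> space M \<Longrightarrow> \<sigma> \<gamma> x \<in> space M"
  using action_measurable by (rule measurable_space)

lemma action_add: "x \<in> space M \<Longrightarrow> \<sigma> \<gamma> (\<sigma> \<gamma>' x) = \<sigma> (\<gamma> + \<gamma>') x"
  using action by (simp add: measurable_action_def)

lemma action_zero: "x \<in> space M \<Longrightarrow> \<sigma> 0 x = x"
  using action by (simp add: measurable_action_def)

lemma action_inverse: "x \<in> space M \<Longrightarrow> \<sigma> (- \<gamma>) (\<sigma> \<gamma> x) = x" "x \<in> space M \<Longrightarrow> \<sigma> \<gamma> (\<sigma> (- \<gamma>) x) = x"
  by (simp_all add: action_add action_zero)

lemma action_image_iff:
  assumes "E \<in> sets M" "x \<in> space M"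
  shows "\<sigma> \<gamma> x \<in> \<sigma> \<gamma> ` E \<longleftrightarrow> x \<in> E"
proof
  assume "\<sigma> \<gamma> x \<in> \<sigma> \<gamma> ` E"
  then obtain y where y: "y \<in> E" "\<sigma> \<gamma> x = \<sigma> \<gamma> y" by (rule imageE)
  have "y \<in> space M" using y(1) sets.sets_into_space[OF assms(1)] by (rule subsetD[rotated])
  have "x = \<sigma> (- \<gamma>) (\<sigma> \<gamma> x)" using assms(2) by (rule action_inverse(1)[symmetric])
  also have "\<dots> = y" unfolding y(2) using \<open>y \<in> space M\<close> by (rule action_inverse(1))
  finally show "x \<in> E" using y by (simp only:)
qed (rule imageI)

text \<open>As preimages under the inverse map, the images occurring in the Jacobian and tiling
  conditions are measurable.\<close>

lemma action_image_eq:
  assumes "E \<in> sets M"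
  shows "\<sigma> \<gamma> ` E = \<sigma> (- \<gamma>) -` E \<inter> space M"
proof (intro equalityI subsetI)
  fix y assume "y \<in> \<sigma> \<gamma> ` E"
  then show "y \<in> \<sigma> (- \<gamma>) -` E \<inter> space M"
  proof
    fix z assume z: "y = \<sigma> \<gamma> z" "z \<in> E"
    then have "z \<in> space M" using sets.sets_into_space[OF assms] by auto
    with z show ?thesis by (simp add: action_inverse action_space)
  qed
next
  fix y assume "y \<in> \<sigma> (- \<gamma>) -` E \<inter> space M"
  then show "y \<in> \<sigma> \<gamma> ` E"
    by (intro image_eqI[of _ _ "\<sigma> (- \<gamma>) y"]) (simp_all add: action_inverse)
qed

lemma action_image_sets [measurable]: "E \<in> sets M \<Longrightarrow> \<sigma> \<gamma> ` E \<in> sets M"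
  unfolding action_image_eq by (rule measurable_sets[OF action_measurable])

lemma jacobian_measurable [measurable]: "J \<gamma> \<in> borel_measurable M"
proof -
  have "(\<lambda>(\<gamma>, x). J \<gamma> x) \<in> borel_measurable (count_space UNIV \<Otimes>\<^sub>M M)"
    using jacobian by (simp add: is_jacobian_def)
  from measurable_compose[OF measurable_Pair1' this, of \<gamma>] show ?thesis
    by (simp add: case_prod_unfold)
qed

lemma jacobian_pos: "x \<in> space M \<Longrightarrow> 0 < J \<gamma> x"
  using jacobian by (simp add: is_jacobian_def)

lemma emeasure_action_image:
  "E \<in> sets M \<Longrightarrow> emeasure M (\<sigma> \<gamma> ` E) = (\<integral>\<^sup>+x. ennreal (J \<gamma> x) * indicator E x \<partial>M)"
  using jacobian by (simp add: is_jacobian_def)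

text \<open>The Jacobian condition, applied to the preimage of E, read as an equality of measures.
  In this form it yields the change of variables for all nonnegative measurable functions.\<close>

lemma distr_density_jacobian: "distr (density M (\<lambda>x. ennreal (J \<gamma> x))) M (\<sigma> \<gamma>) = M"
proof (rule measure_eqI)
  fix E assume "E \<in> sets (distr (density M (\<lambda>x. ennreal (J \<gamma> x))) M (\<sigma> \<gamma>))"
  then have E [measurable]: "E \<in> sets M" by simp
  have "\<sigma> \<gamma> -` E \<inter> space M \<in> sets M" by measurable
  moreover have "\<sigma> \<gamma> ` (\<sigma> \<gamma> -` E \<inter> space M) = E"
  proof (intro equalityI subsetI)
    fix y assume "y \<in> E"
    then have "y \<in> space M" using sets.sets_into_space[OF E] by auto
    with \<open>y \<in> E\<close> show "y \<in> \<sigma> \<gamma> ` (\<sigma> \<gamma> -` E \<inter> space M)"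
      by (intro image_eqI[of _ _ "\<sigma> (- \<gamma>) y"]) (simp_all add: action_inverse action_space)
  qed auto
  ultimately show "emeasure (distr (density M (\<lambda>x. ennreal (J \<gamma> x))) M (\<sigma> \<gamma>)) E = emeasure M E"
    using emeasure_action_image[of "\<sigma> \<gamma> -` E \<inter> space M" \<gamma>]
    by (simp add: emeasure_distr emeasure_density)
qed simp

lemma nn_integral_action:
  assumes [measurable]: "f \<in> borel_measurable M"
  shows "(\<integral>\<^sup>+x. f x \<partial>M) = (\<integral>\<^sup>+x. ennreal (J \<gamma> x) * f (\<sigma> \<gamma> x) \<partial>M)"
proof -
  have "(\<integral>\<^sup>+x. f x \<partial>M) = (\<integral>\<^sup>+x. f x \<partial>distr (density M (\<lambda>x. ennreal (J \<gamma> x))) M (\<sigma> \<gamma>))"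
    by (simp add: distr_density_jacobian)
  also have "\<dots> = (\<integral>\<^sup>+x. ennreal (J \<gamma> x) * f (\<sigma> \<gamma> x) \<partial>M)"
    by (simp add: nn_integral_distr nn_integral_density)
  finally show ?thesis .
qed

lemma jacobian_cocycle: "AE x in M. J (\<gamma> + \<delta>) x = J \<gamma> (\<sigma> \<delta> x) * J \<delta> x"
proof -
  have "AE x in M. ennreal (J (\<gamma> + \<delta>) x) = ennreal (J \<gamma> (\<sigma> \<delta> x) * J \<delta> x)"
  proof (rule density_unique2)
    fix E assume E [measurable]: "E \<in> sets M"
    have "(\<integral>\<^sup>+x. ennreal (J (\<gamma> + \<delta>) x) * indicator E x \<partial>M) = emeasure M (\<sigma> (\<gamma> + \<delta>) ` E)"
      by (simp add: emeasure_action_image)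
    also have "\<sigma> (\<gamma> + \<delta>) ` E = \<sigma> \<gamma> ` (\<sigma> \<delta> ` E)"
      using sets.sets_into_space[OF E] unfolding image_image
      by (intro image_cong refl) (simp add: action_add subset_iff)
    also have "emeasure M \<dots> = (\<integral>\<^sup>+x. ennreal (J \<gamma> x) * indicator (\<sigma> \<delta> ` E) x \<partial>M)"
      by (simp add: emeasure_action_image)
    also have "\<dots> = (\<integral>\<^sup>+x. ennreal (J \<delta> x) * (ennreal (J \<gamma> (\<sigma> \<delta> x)) * indicator (\<sigma> \<delta> ` E) (\<sigma> \<delta> x)) \<partial>M)"
      by (rule nn_integral_action) measurable
    also have "\<dots> = (\<integral>\<^sup>+x. ennreal (J \<gamma> (\<sigma> \<delta> x) * J \<delta> x) * indicator E x \<partial>M)"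
      by (rule nn_integral_cong)
        (auto simp: indicator_def action_image_iff ennreal_mult jacobian_pos less_imp_le action_space mult.commute)
    finally show "(\<integral>\<^sup>+x. ennreal (J (\<gamma> + \<delta>) x) * indicator E x \<partial>M)
      = (\<integral>\<^sup>+x. ennreal (J \<gamma> (\<sigma> \<delta> x) * J \<delta> x) * indicator E x \<partial>M)" .
  qed measurable
  then show ?thesis
  proof (rule AE_mp[OF _ AE_I2], intro impI)
    fix x assume x: "x \<in> space M" and "ennreal (J (\<gamma> + \<delta>) x) = ennreal (J \<gamma> (\<sigma> \<delta> x) * J \<delta> x)"
    moreover have "0 \<le> J (\<gamma> + \<delta>) x" "0 \<le> J \<gamma> (\<sigma> \<delta> x) * J \<delta> x"
      using x jacobian_pos action_space by (auto intro!: mult_nonneg_nonneg less_imp_le)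
    ultimately show "J (\<gamma> + \<delta>) x = J \<gamma> (\<sigma> \<delta> x) * J \<delta> x"
      by (simp only: ennreal_inj)
  qed
qed

section \<open>The unitary representation and its decomposition over the tiles\<close>

lemma action_rep_measurable [measurable]:
  assumes [measurable]: "\<psi> \<in> borel_measurable M"
  shows "action_rep \<sigma> J \<gamma> \<psi> \<in> borel_measurable M"
  unfolding action_rep_def[abs_def] by measurable

lemma norm_action_rep:
  "x \<in> space M \<Longrightarrow> (norm (action_rep \<sigma> J \<gamma> \<psi> x))\<^sup>2 = J (- \<gamma>) x * (norm (\<psi> (\<sigma> (- \<gamma>) x)))\<^sup>2"
  using jacobian_pos[of x "- \<gamma>"] by (simp add: action_rep_def norm_mult power_mult_distrib)

lemma action_rep_energy:
  assumes [measurable]: "\<psi> \<in> borel_measurable M"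
  shows "L2_energy M (action_rep \<sigma> J \<gamma> \<psi>) = L2_energy M \<psi>"
proof -
  have "L2_energy M (action_rep \<sigma> J \<gamma> \<psi>)
      = (\<integral>\<^sup>+x. ennreal (J (- \<gamma>) x) * ennreal ((norm (\<psi> (\<sigma> (- \<gamma>) x)))\<^sup>2) \<partial>M)"
    unfolding L2_energy_def
    by (rule nn_integral_cong) (simp add: norm_action_rep ennreal_mult jacobian_pos less_imp_le)
  also have "\<dots> = L2_energy M \<psi>"
    unfolding L2_energy_def by (rule nn_integral_action[symmetric]) measurable
  finally show ?thesis .
qed

lemma action_rep_L2: "\<psi> \<in> L2 M \<Longrightarrow> action_rep \<sigma> J \<gamma> \<psi> \<in> L2 M"
  by (auto simp: L2_iff_energy action_rep_energy action_rep_measurable)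

text \<open>The homomorphism property of the representation, from the cocycle identity at (- g i, -
  \<gamma>). Countability of the group merges all exceptional sets into one, so that whole sequences
  indexed by \<gamma> can be compared at a point x.\<close>

lemma action_rep_sum:
  assumes "finite F"
  shows "AE x in M. \<forall>\<gamma>. action_rep \<sigma> J \<gamma> (\<lambda>x. \<Sum>i\<in>F. a i * action_rep \<sigma> J (g i) (f i) x) x
    = (\<Sum>i\<in>F. a i * action_rep \<sigma> J (\<gamma> + g i) (f i) x)"
proof -
  have "AE x in M. \<forall>\<gamma> \<delta>. J (\<gamma> + \<delta>) x = J \<gamma> (\<sigma> \<delta> x) * J \<delta> x"
    by (simp add: AE_all_countable jacobian_cocycle)
  then show ?thesis
  proof (rule AE_mp[OF _ AE_I2], intro impI allI)
    fix x \<gamma> assume x: "x \<in> space M" and coc: "\<forall>\<gamma> \<delta>. J (\<gamma> + \<delta>) x = J \<gamma> (\<sigma> \<delta> x) * J \<delta> x"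
    have "sqrt (J (- (\<gamma> + g i)) x) = sqrt (J (- \<gamma>) x) * sqrt (J (- g i) (\<sigma> (- \<gamma>) x))" for i
      using coc[rule_format, of "- g i" "- \<gamma>"] by (simp add: real_sqrt_mult mult.commute add.commute)
    moreover have "\<sigma> (- (\<gamma> + g i)) x = \<sigma> (- g i) (\<sigma> (- \<gamma>) x)" for i
      using x by (simp add: action_add add.commute)
    ultimately show "action_rep \<sigma> J \<gamma> (\<lambda>x. \<Sum>i\<in>F. a i * action_rep \<sigma> J (g i) (f i) x) x
      = (\<Sum>i\<in>F. a i * action_rep \<sigma> J (\<gamma> + g i) (f i) x)"
      by (simp only: action_rep_def sum_distrib_left of_real_mult mult_ac)
  qed
qed

text \<open>Cut the integral into tiles and pull each tile back to C. The Jacobian produced by the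
  change of variables is the one built into the representation, so each tile contributes the energy
  of a translate of G on C.\<close>

lemma tiling_energy:
  assumes C: "tiling_set M \<sigma> C" and [measurable]: "G \<in> borel_measurable M"
  shows "L2_energy M G
    = (\<integral>\<^sup>+x. (\<integral>\<^sup>+\<gamma>. ennreal ((norm (action_rep \<sigma> J \<gamma> G x))\<^sup>2) \<partial>count_space UNIV) \<partial>restrict_space M C)"
proof -
  have [measurable]: "C \<in> sets M" using C by (simp add: tiling_set_def)
  have "AE x in M. x \<notin> space M - (\<Union>\<gamma>. \<sigma> \<gamma> ` C)"
    using C by (intro AE_not_in null_setsI) (auto simp: tiling_set_def)
  moreover have "AE x in M. \<forall>\<gamma> \<gamma>'. \<gamma> \<noteq> \<gamma>' \<longrightarrow> x \<notin> \<sigma> \<gamma> ` C \<inter> \<sigma> \<gamma>' ` C"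
    unfolding AE_all_countable
  proof (intro allI)
    fix \<gamma> \<gamma>' :: 'g
    show "AE x in M. \<gamma> \<noteq> \<gamma>' \<longrightarrow> x \<notin> \<sigma> \<gamma> ` C \<inter> \<sigma> \<gamma>' ` C"
      using C by (cases "\<gamma> = \<gamma>'") (auto simp: tiling_set_def simp del: Int_iff intro!: AE_not_in null_setsI)
  qed
  \<comment> \<open>Almost every point lies in exactly one tile, so inserting the sum of the tile
    indicators leaves the integral unchanged.\<close>
  ultimately have one: "AE x in M. (\<integral>\<^sup>+\<gamma>. indicator (\<sigma> \<gamma> ` C) x \<partial>count_space UNIV) = (1::ennreal)"
    using AE_space
  proof eventually_elim
    case (elim x)
    then obtain \<gamma>0 where \<gamma>0: "x \<in> \<sigma> \<gamma>0 ` C" by blast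
    have "x \<notin> \<sigma> \<gamma> ` C" if "\<gamma> \<noteq> \<gamma>0" for \<gamma>
      using elim(2) \<gamma>0 that by blast
    then have "(\<integral>\<^sup>+\<gamma>. indicator (\<sigma> \<gamma> ` C) x \<partial>count_space UNIV) = (\<Sum>\<gamma>\<in>{\<gamma>0}. indicator (\<sigma> \<gamma> ` C) x :: ennreal)"
      by (intro nn_integral_count_space') auto
    then show ?case using \<gamma>0 by simp
  qed
  let ?G = "\<lambda>x. ennreal ((norm (G x))\<^sup>2)"
  have "L2_energy M G = (\<integral>\<^sup>+x. (\<integral>\<^sup>+\<gamma>. ?G x * indicator (\<sigma> \<gamma> ` C) x \<partial>count_space UNIV) \<partial>M)"
    unfolding L2_energy_def
    by (rule nn_integral_cong_AE, use one in eventually_elim) (simp add: nn_integral_cmult)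
  also have "\<dots> = (\<integral>\<^sup>+\<gamma>. (\<integral>\<^sup>+x. ?G x * indicator (\<sigma> \<gamma> ` C) x \<partial>M) \<partial>count_space UNIV)"
    by (rule nn_integral_count_space_nn_integral) auto
  also have "\<dots> = (\<integral>\<^sup>+\<gamma>. (\<integral>\<^sup>+x. ennreal ((norm (action_rep \<sigma> J (- \<gamma>) G x))\<^sup>2) \<partial>restrict_space M C) \<partial>count_space UNIV)"
  proof (rule nn_integral_cong)
    fix \<gamma> :: 'g
    have "(\<integral>\<^sup>+x. ?G x * indicator (\<sigma> \<gamma> ` C) x \<partial>M)
        = (\<integral>\<^sup>+x. ennreal (J \<gamma> x) * (?G (\<sigma> \<gamma> x) * indicator (\<sigma> \<gamma> ` C) (\<sigma> \<gamma> x)) \<partial>M)"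
      by (rule nn_integral_action) measurable
    also have "\<dots> = (\<integral>\<^sup>+x. ennreal ((norm (action_rep \<sigma> J (- \<gamma>) G x))\<^sup>2) * indicator C x \<partial>M)"
      by (rule nn_integral_cong)
        (auto simp: norm_action_rep indicator_def action_image_iff ennreal_mult jacobian_pos less_imp_le)
    also have "\<dots> = (\<integral>\<^sup>+x. ennreal ((norm (action_rep \<sigma> J (- \<gamma>) G x))\<^sup>2) \<partial>restrict_space M C)"
      by (simp add: nn_integral_restrict_space)
    finally show "(\<integral>\<^sup>+x. ?G x * indicator (\<sigma> \<gamma> ` C) x \<partial>M) = \<dots>" .
  qed
  \<comment> \<open>Pulling back the tile of \<gamma> gives the representation at - \<gamma>;
    inversion permutes the group, so the total is unaffected.\<close>
  also have "\<dots> = (\<integral>\<^sup>+\<gamma>. (\<integral>\<^sup>+x. ennreal ((norm (action_rep \<sigma> J \<gamma> G x))\<^sup>2) \<partial>restrict_space M C) \<partial>count_space UNIV)"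
    by (rule nn_integral_bij_count_space[of uminus UNIV UNIV
          "\<lambda>\<gamma>. \<integral>\<^sup>+x. ennreal ((norm (action_rep \<sigma> J \<gamma> G x))\<^sup>2) \<partial>restrict_space M C"])
      (auto intro!: bij_betwI[where g = uminus])
  also have "\<dots> = (\<integral>\<^sup>+x. (\<integral>\<^sup>+\<gamma>. ennreal ((norm (action_rep \<sigma> J \<gamma> G x))\<^sup>2) \<partial>count_space UNIV) \<partial>restrict_space M C)"
    by (rule nn_integral_count_space_nn_integral[symmetric]) (auto intro!: measurable_restrict_space1)
  finally show ?thesis .
qed

end

section \<open>The Zak transform\<close>

lemma borel_measurable_nn_integral_count_space:
  fixes f :: "'i::countable \<Rightarrow> 'a \<Rightarrow> ennreal"
  assumes "\<And>i. f i \<in> borel_measurable M"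
  shows "(\<lambda>x. \<integral>\<^sup>+i. f i x \<partial>count_space UNIV) \<in> borel_measurable M"
proof -
  have [measurable]: "(\<lambda>(i, x). f i x) \<in> borel_measurable (count_space UNIV \<Otimes>\<^sub>M M)"
    by (rule measurable_pair_measure_countable1) (use assms in auto)
  have "(\<lambda>p. (\<lambda>(i, x). f i x) (snd p, fst p)) \<in> borel_measurable (M \<Otimes>\<^sub>M count_space UNIV)"
    by measurable
  from sigma_finite_measure.borel_measurable_nn_integral_fst[OF sigma_finite_measure_count_space this]
  show ?thesis by simp
qed

section \<open>The Fourier transform from square-summable sequences to the dual group\<close>

context haar
begin

lemma sigma_finite_haar: "sigma_finite_measure m"
  by (rule sigma_finite_measure_axioms)

lemma fourier_partial_L2: "(\<lambda>\<alpha>. \<Sum>\<gamma>\<in>K. c \<gamma> * \<alpha> (- \<gamma>)) \<in> L2 m"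
  using char_sum_in_L2[of c uminus K] .

lemma fourier_partial_energy:
  "finite K \<Longrightarrow> L2_energy m (\<lambda>\<alpha>. \<Sum>\<gamma>\<in>K. c \<gamma> * \<alpha> (- \<gamma>)) = ennreal (\<Sum>\<gamma>\<in>K. (norm (c \<gamma>))\<^sup>2)"
  using char_sum_energy[of K uminus c] by simp

lemma fourier_zero: "is_L2_fourier m (\<lambda>_. 0) (\<lambda>_. 0)"
  by (simp add: is_L2_fourier_def L2_zero L2_norm_def)

lemma fourier_add:
  assumes "is_L2_fourier m c F" "is_L2_fourier m d G"
  shows "is_L2_fourier m (\<lambda>\<gamma>. c \<gamma> + d \<gamma>) (\<lambda>\<alpha>. F \<alpha> + G \<alpha>)"
proof -
  have F: "F \<in> L2 m" and G: "G \<in> L2 m" using assms by (auto simp: is_L2_fourier_def)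
  let ?f = "\<lambda>K \<alpha>. F \<alpha> - (\<Sum>\<gamma>\<in>K. c \<gamma> * \<alpha> (- \<gamma>))" and ?g = "\<lambda>K \<alpha>. G \<alpha> - (\<Sum>\<gamma>\<in>K. d \<gamma> * \<alpha> (- \<gamma>))"
  have "((\<lambda>K. L2_norm m (\<lambda>\<alpha>. (F \<alpha> + G \<alpha>) - (\<Sum>\<gamma>\<in>K. (c \<gamma> + d \<gamma>) * \<alpha> (- \<gamma>)))) \<longlongrightarrow> 0)
      (finite_subsets_at_top UNIV)"
  proof (rule tendsto_sandwich[OF _ _ tendsto_const])
    show "((\<lambda>K. L2_norm m (?f K) + L2_norm m (?g K)) \<longlongrightarrow> 0) (finite_subsets_at_top UNIV)"
      using assms by (auto simp: is_L2_fourier_def intro!: tendsto_add_zero)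
    have "L2_norm m (\<lambda>\<alpha>. (F \<alpha> + G \<alpha>) - (\<Sum>\<gamma>\<in>K. (c \<gamma> + d \<gamma>) * \<alpha> (- \<gamma>))) \<le> L2_norm m (?f K) + L2_norm m (?g K)" for K
      using L2_norm_triangle[OF L2_diff[OF F fourier_partial_L2[of c K]] L2_diff[OF G fourier_partial_L2[of d K]]]
      by (simp add: algebra_simps sum.distrib)
    then show "\<forall>\<^sub>F K in finite_subsets_at_top UNIV.
        L2_norm m (\<lambda>\<alpha>. (F \<alpha> + G \<alpha>) - (\<Sum>\<gamma>\<in>K. (c \<gamma> + d \<gamma>) * \<alpha> (- \<gamma>))) \<le> L2_norm m (?f K) + L2_norm m (?g K)"
      by simp
  qed simp
  with F G show ?thesis by (simp add: is_L2_fourier_def L2_add)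
qed

lemma fourier_scale:
  assumes "is_L2_fourier m c F"
  shows "is_L2_fourier m (\<lambda>\<gamma>. a * c \<gamma>) (\<lambda>\<alpha>. a * F \<alpha>)"
proof -
  have "L2_norm m (\<lambda>\<alpha>. a * F \<alpha> - (\<Sum>\<gamma>\<in>K. a * c \<gamma> * \<alpha> (- \<gamma>)))
      = norm a * L2_norm m (\<lambda>\<alpha>. F \<alpha> - (\<Sum>\<gamma>\<in>K. c \<gamma> * \<alpha> (- \<gamma>)))" for K
    unfolding L2_norm_scale[symmetric] by (simp add: right_diff_distrib sum_distrib_left mult.assoc)
  with assms show ?thesis
    by (auto simp: is_L2_fourier_def L2_scale intro!: tendsto_mult_right_zero)
qed

lemma fourier_sum:
  assumes "finite I" "\<And>i. i \<in> I \<Longrightarrow> is_L2_fourier m (c i) (F i)"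
  shows "is_L2_fourier m (\<lambda>\<gamma>. \<Sum>i\<in>I. c i \<gamma>) (\<lambda>\<alpha>. \<Sum>i\<in>I. F i \<alpha>)"
  using assms
proof (induction I rule: finite_induct)
  case (insert i I)
  then show ?case using fourier_add[of "c i" "F i"] by simp
qed (simp add: fourier_zero)

lemma eval_mult_L2:
  assumes "F \<in> L2 m"
  shows "(\<lambda>\<alpha>. \<alpha> \<delta> * F \<alpha>) \<in> L2 m" "L2_norm m (\<lambda>\<alpha>. \<alpha> \<delta> * F \<alpha>) = L2_norm m F"
proof -
  have [measurable]: "F \<in> borel_measurable m" using assms by (rule L2_measurable)
  have eq: "norm (\<alpha> \<delta> * F \<alpha>) = norm (F \<alpha>)" if "\<alpha> \<in> space m" for \<alpha>
    using that by (simp add: space_haar norm_mult dual_norm)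
  show "L2_norm m (\<lambda>\<alpha>. \<alpha> \<delta> * F \<alpha>) = L2_norm m F"
    unfolding L2_norm_def by (simp add: eq cong: Bochner_Integration.integral_cong)
  have "L2_energy m (\<lambda>\<alpha>. \<alpha> \<delta> * F \<alpha>) = L2_energy m F"
    unfolding L2_energy_def by (rule nn_integral_cong) (simp add: eq)
  with assms show "(\<lambda>\<alpha>. \<alpha> \<delta> * F \<alpha>) \<in> L2 m"
    by (simp add: L2_iff_energy)
qed

text \<open>Multiplication by the unimodular \<alpha> \<delta> preserves the norm and turns the
  partial sum over K + \<delta> into the shifted one over K. Translation by \<delta> permutes the
  finite subsets cofinally, so the limit survives.\<close>

lemma fourier_shift:
  assumes "is_L2_fourier m c F"
  shows "is_L2_fourier m (\<lambda>\<gamma>. c (\<gamma> + \<delta>)) (\<lambda>\<alpha>. \<alpha> \<delta> * F \<alpha>)"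
proof -
  have F: "F \<in> L2 m" using assms by (auto simp: is_L2_fourier_def)
  let ?f = "\<lambda>K \<alpha>. F \<alpha> - (\<Sum>\<gamma>\<in>K. c \<gamma> * \<alpha> (- \<gamma>))"
  have "filtermap ((`) (\<lambda>\<gamma>. \<gamma> + \<delta>)) (finite_subsets_at_top UNIV) = finite_subsets_at_top ((\<lambda>\<gamma>. \<gamma> + \<delta>) ` UNIV)"
    by (rule filtermap_image_finite_subsets_at_top) (simp add: inj_on_def)
  then have "filterlim ((`) (\<lambda>\<gamma>. \<gamma> + \<delta>)) (finite_subsets_at_top UNIV) (finite_subsets_at_top UNIV)"
    by (simp add: filterlim_def)
  moreover have "((\<lambda>K. L2_norm m (?f K)) \<longlongrightarrow> 0) (finite_subsets_at_top UNIV)"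
    using assms by (simp add: is_L2_fourier_def)
  ultimately have lim: "((\<lambda>K. L2_norm m (?f ((\<lambda>\<gamma>. \<gamma> + \<delta>) ` K))) \<longlongrightarrow> 0) (finite_subsets_at_top UNIV)"
    by (rule filterlim_compose[rotated])
  have "L2_norm m (?f ((\<lambda>\<gamma>. \<gamma> + \<delta>) ` K))
      = L2_norm m (\<lambda>\<alpha>. \<alpha> \<delta> * F \<alpha> - (\<Sum>\<gamma>\<in>K. c (\<gamma> + \<delta>) * \<alpha> (- \<gamma>)))" for K
  proof -
    have "L2_norm m (?f ((\<lambda>\<gamma>. \<gamma> + \<delta>) ` K)) = L2_norm m (\<lambda>\<alpha>. \<alpha> \<delta> * ?f ((\<lambda>\<gamma>. \<gamma> + \<delta>) ` K) \<alpha>)"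
      by (rule eval_mult_L2(2)[symmetric]) (rule L2_diff[OF F fourier_partial_L2])
    also have "\<dots> = L2_norm m (\<lambda>\<alpha>. \<alpha> \<delta> * F \<alpha> - (\<Sum>\<gamma>\<in>K. c (\<gamma> + \<delta>) * \<alpha> (- \<gamma>)))"
      unfolding L2_norm_def
    proof (intro arg_cong[where f = sqrt] Bochner_Integration.integral_cong refl)
      fix \<alpha> assume \<alpha>: "\<alpha> \<in> space m"
      have "\<alpha> \<delta> * (\<Sum>\<gamma>\<in>(\<lambda>\<gamma>. \<gamma> + \<delta>) ` K. c \<gamma> * \<alpha> (- \<gamma>)) = (\<Sum>\<gamma>\<in>K. \<alpha> \<delta> * (c (\<gamma> + \<delta>) * \<alpha> (- (\<gamma> + \<delta>))))"
        by (subst sum.reindex) (simp_all add: inj_on_def sum_distrib_left)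
      also have "\<dots> = (\<Sum>\<gamma>\<in>K. c (\<gamma> + \<delta>) * \<alpha> (- \<gamma>))"
      proof (rule sum.cong[OF refl])
        fix \<gamma>
        have "\<alpha> (- \<gamma>) = \<alpha> \<delta> * \<alpha> (- (\<gamma> + \<delta>))"
          using \<alpha> dual_add[of \<alpha> \<delta> "- (\<gamma> + \<delta>)"] by (simp add: space_haar)
        then show "\<alpha> \<delta> * (c (\<gamma> + \<delta>) * \<alpha> (- (\<gamma> + \<delta>))) = c (\<gamma> + \<delta>) * \<alpha> (- \<gamma>)"
          by (simp only: mult_ac)
      qed
      finally show "(norm (\<alpha> \<delta> * ?f ((\<lambda>\<gamma>. \<gamma> + \<delta>) ` K) \<alpha>))\<^sup>2
          = (norm (\<alpha> \<delta> * F \<alpha> - (\<Sum>\<gamma>\<in>K. c (\<gamma> + \<delta>) * \<alpha> (- \<gamma>))))\<^sup>2"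
        by (simp only: right_diff_distrib)
    qed
    finally show ?thesis .
  qed
  with lim eval_mult_L2(1)[OF F] show ?thesis
    by (simp add: is_L2_fourier_def)
qed

text \<open>By the reverse triangle inequality the norms of the partial sums converge to that of F;
  by orthonormality their squares are the partial sums of |c|^2.\<close>

lemma fourier_parseval:
  assumes "is_L2_fourier m c F"
  shows "(\<integral>\<^sup>+\<gamma>. ennreal ((norm (c \<gamma>))\<^sup>2) \<partial>count_space UNIV) = L2_energy m F"
proof -
  have F: "F \<in> L2 m" using assms by (auto simp: is_L2_fourier_def)
  let ?S = "\<lambda>K \<alpha>. \<Sum>\<gamma>\<in>K. c \<gamma> * \<alpha> (- \<gamma>)"
  have S: "?S K \<in> L2 m" for K by (rule fourier_partial_L2)
  have "((\<lambda>K. L2_norm m F - L2_norm m (?S K)) \<longlongrightarrow> 0) (finite_subsets_at_top UNIV)"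
  proof (rule tendsto_rabs_zero_cancel, rule tendsto_sandwich[OF _ _ tendsto_const])
    show "((\<lambda>K. L2_norm m (\<lambda>\<alpha>. F \<alpha> - ?S K \<alpha>)) \<longlongrightarrow> 0) (finite_subsets_at_top UNIV)"
      using assms by (simp add: is_L2_fourier_def)
    show "\<forall>\<^sub>F K in finite_subsets_at_top UNIV. \<bar>L2_norm m F - L2_norm m (?S K)\<bar> \<le> L2_norm m (\<lambda>\<alpha>. F \<alpha> - ?S K \<alpha>)"
      by (simp add: L2_norm_diff_bound[OF F S])
  qed simp
  then have "((\<lambda>K. L2_norm m F - (L2_norm m F - L2_norm m (?S K))) \<longlongrightarrow> L2_norm m F - 0) (finite_subsets_at_top UNIV)"
    by (intro tendsto_intros)
  then have "((\<lambda>K. (L2_norm m (?S K))\<^sup>2) \<longlongrightarrow> (L2_norm m F)\<^sup>2) (finite_subsets_at_top UNIV)"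
    by (intro tendsto_power) simp
  moreover have "\<forall>\<^sub>F K in finite_subsets_at_top UNIV. (L2_norm m (?S K))\<^sup>2 = (\<Sum>\<gamma>\<in>K. (norm (c \<gamma>))\<^sup>2)"
  proof (rule eventually_finite_subsets_at_top_weakI)
    fix K :: "'g set" assume "finite K"
    then show "(L2_norm m (?S K))\<^sup>2 = (\<Sum>\<gamma>\<in>K. (norm (c \<gamma>))\<^sup>2)"
      using fourier_partial_energy[of K c] L2_energy_eq[OF S, of K]
      by (simp add: ennreal_inj sum_nonneg)
  qed
  ultimately have "((\<lambda>\<gamma>. (norm (c \<gamma>))\<^sup>2) has_sum (L2_norm m F)\<^sup>2) UNIV"
    unfolding has_sum_def by (rule Lim_transform_eventually)
  then show ?thesis
    by (simp add: nn_integral_count_space_has_sum L2_energy_eq[OF F])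
qed

end

section \<open>Construction of the Zak transform on the product of the dual group and the
  tile\<close>

locale zak_setting = haar m + jacobian_action M \<sigma> J
  for m :: "('g::{ab_group_add,countable} \<Rightarrow> complex) measure"
    and M :: "'x measure" and \<sigma> :: "'g \<Rightarrow> 'x \<Rightarrow> 'x" and J :: "'g \<Rightarrow> 'x \<Rightarrow> real" +
  fixes C :: "'x set"
  assumes tiling: "tiling_set M \<sigma> C"
begin

abbreviation "MC \<equiv> restrict_space M C"

lemma tile_sets [measurable]: "C \<in> sets M"
  using tiling by (simp add: tiling_set_def)

sublocale MC: sigma_finite_measure MC
  by (rule sigma_finite_measure_restrict_space[OF sigma_finite_measure_axioms tile_sets])

sublocale P: pair_sigma_finite m MC ..

lemma action_rep_measurable_tile [measurable]:
  "\<psi> \<in> borel_measurable M \<Longrightarrow> action_rep \<sigma> J \<gamma> \<psi> \<in> borel_measurable MC"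
  by (intro measurable_restrict_space1 action_rep_measurable)

text \<open>Tonelli's theorem in both orders: slices at fixed x carry Fourier series, slices at
  fixed \<alpha> are the fibres in which the Riesz bounds are stated.\<close>

lemma energy_slices:
  assumes [measurable]: "(\<lambda>(\<alpha>, x). Z \<alpha> x) \<in> borel_measurable (m \<Otimes>\<^sub>M MC)"
  shows "L2_energy (m \<Otimes>\<^sub>M MC) (\<lambda>(\<alpha>, x). Z \<alpha> x) = (\<integral>\<^sup>+x. L2_energy m (\<lambda>\<alpha>. Z \<alpha> x) \<partial>MC)"
    and "L2_energy (m \<Otimes>\<^sub>M MC) (\<lambda>(\<alpha>, x). Z \<alpha> x) = (\<integral>\<^sup>+\<alpha>. L2_energy MC (Z \<alpha>) \<partial>m)"
    and "(\<lambda>x. L2_energy m (\<lambda>\<alpha>. Z \<alpha> x)) \<in> borel_measurable MC"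
    and "(\<lambda>\<alpha>. L2_energy MC (Z \<alpha>)) \<in> borel_measurable m"
proof -
  let ?f = "\<lambda>p. ennreal ((norm (case p of (\<alpha>, x) \<Rightarrow> Z \<alpha> x))\<^sup>2)"
  have f: "?f \<in> borel_measurable (m \<Otimes>\<^sub>M MC)" by measurable
  show "L2_energy (m \<Otimes>\<^sub>M MC) (\<lambda>(\<alpha>, x). Z \<alpha> x) = (\<integral>\<^sup>+x. L2_energy m (\<lambda>\<alpha>. Z \<alpha> x) \<partial>MC)"
    unfolding L2_energy_def using P.nn_integral_snd[OF f] by simp
  show "L2_energy (m \<Otimes>\<^sub>M MC) (\<lambda>(\<alpha>, x). Z \<alpha> x) = (\<integral>\<^sup>+\<alpha>. L2_energy MC (Z \<alpha>) \<partial>m)"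
    unfolding L2_energy_def using MC.nn_integral_fst[OF f] by simp
  show "(\<lambda>\<alpha>. L2_energy MC (Z \<alpha>)) \<in> borel_measurable m"
    unfolding L2_energy_def using MC.borel_measurable_nn_integral_fst[OF f] by simp
  have "(\<lambda>p. ?f (snd p, fst p)) \<in> borel_measurable (MC \<Otimes>\<^sub>M m)"
    by measurable
  from sigma_finite_measure.borel_measurable_nn_integral_fst[OF sigma_finite_haar this]
  show "(\<lambda>x. L2_energy m (\<lambda>\<alpha>. Z \<alpha> x)) \<in> borel_measurable MC"
    unfolding L2_energy_def by simp
qed

lemma slice_measurable:
  assumes "(\<lambda>(\<alpha>, x). Z \<alpha> x) \<in> borel_measurable (m \<Otimes>\<^sub>M MC)"
  shows "x \<in> space MC \<Longrightarrow> (\<lambda>\<alpha>. Z \<alpha> x) \<in> borel_measurable m"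
    and "\<alpha> \<in> space m \<Longrightarrow> Z \<alpha> \<in> borel_measurable MC"
  using measurable_compose[OF measurable_Pair2' assms] measurable_compose[OF measurable_Pair1' assms]
  by simp_all

lemma AE_slice_L2:
  assumes "(\<lambda>(\<alpha>, x). Z \<alpha> x) \<in> L2 (m \<Otimes>\<^sub>M MC)"
  shows "AE \<alpha> in m. Z \<alpha> \<in> L2 MC"
proof -
  have meas: "(\<lambda>(\<alpha>, x). Z \<alpha> x) \<in> borel_measurable (m \<Otimes>\<^sub>M MC)"
    using assms by (rule L2_measurable)
  have "(\<integral>\<^sup>+\<alpha>. L2_energy MC (Z \<alpha>) \<partial>m) \<noteq> \<infinity>"
    using assms energy_slices(2)[OF meas] by (auto simp: L2_iff_energy)
  then have "AE \<alpha> in m. L2_energy MC (Z \<alpha>) \<noteq> \<infinity>"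
    by (intro nn_integral_noteq_infinite energy_slices(4)[OF meas])
  then show ?thesis
    using AE_space
    by eventually_elim (auto simp: L2_iff_energy slice_measurable[OF meas] less_top)
qed

text \<open>By the tiling identity the partial sums are Cauchy in the product space, so a fast
  subsequence \<open>Ks\<close> has a limit there. Summable errors give convergence along
  \<open>Ks\<close> on almost every x-slice, and square-summability of the coefficients at x
  upgrades this to convergence along all finite sets.\<close>

lemma is_zak_exists:
  assumes \<psi>: "\<psi> \<in> L2 M"
  shows "\<exists>Z. is_zak m M \<sigma> J C \<psi> Z"
proof -
  note [measurable] = L2_measurable[OF \<psi>]
  define u where "u \<gamma> x = action_rep \<sigma> J \<gamma> \<psi> x" for \<gamma> x
  have [measurable]: "u \<gamma> \<in> borel_measurable MC" for \<gamma>
    unfolding u_def[abs_def] by measurable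
  define S where "S K \<alpha> x = (\<Sum>\<gamma>\<in>K. u \<gamma> x * \<alpha> (- \<gamma>))" for K \<alpha> x
  have S_meas [measurable]: "(\<lambda>(\<alpha>, x). S K \<alpha> x) \<in> borel_measurable (m \<Otimes>\<^sub>M MC)" for K
    unfolding S_def by measurable
  have u_fin: "(\<integral>\<^sup>+x. (\<integral>\<^sup>+\<gamma>. ennreal ((norm (u \<gamma> x))\<^sup>2) \<partial>count_space UNIV) \<partial>MC) < \<infinity>"
    using tiling_energy[OF tiling, of \<psi>] \<psi> by (simp add: L2_iff_energy u_def)
  then have tot: "(\<integral>\<^sup>+\<gamma>. L2_energy MC (u \<gamma>) \<partial>count_space UNIV) < \<infinity>"
    unfolding L2_energy_def by (subst nn_integral_count_space_nn_integral[symmetric]) auto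
  have u_L2: "u \<gamma> \<in> L2 MC" for \<gamma>
    using tot nn_integral_ge_point[of \<gamma> UNIV "\<lambda>\<gamma>. L2_energy MC (u \<gamma>)"]
    by (auto simp: L2_iff_energy intro: le_less_trans)
  define v where "v \<gamma> = (L2_norm MC (u \<gamma>))\<^sup>2" for \<gamma>
  have v: "L2_energy MC (u \<gamma>) = ennreal (v \<gamma>)" "0 \<le> v \<gamma>" for \<gamma>
    by (simp_all add: v_def L2_energy_eq[OF u_L2])
  have S_energy: "L2_energy (m \<Otimes>\<^sub>M MC) (\<lambda>(\<alpha>, x). S K \<alpha> x) = ennreal (sum v K)" if "finite K" for K
  proof -
    have "L2_energy (m \<Otimes>\<^sub>M MC) (\<lambda>(\<alpha>, x). S K \<alpha> x) = (\<integral>\<^sup>+x. (\<Sum>\<gamma>\<in>K. ennreal ((norm (u \<gamma> x))\<^sup>2)) \<partial>MC)"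
      using that by (simp add: energy_slices(1) S_def fourier_partial_energy)
    also have "\<dots> = (\<Sum>\<gamma>\<in>K. L2_energy MC (u \<gamma>))"
      unfolding L2_energy_def by (rule nn_integral_sum) simp
    finally show ?thesis by (simp add: v)
  qed
  have S_diff: "S L \<alpha> x - S K \<alpha> x = S (L - K) \<alpha> x" if "finite L" "K \<subseteq> L" for K L \<alpha> x
    using that by (simp add: S_def sum_diff)
  have "\<exists>N. finite N \<and> (\<forall>L. finite L \<longrightarrow> L \<inter> N = {} \<longrightarrow> sum v L < (1/4)^k)" for k :: nat
  proof (rule count_space_tail[of v "(1/4)^k"])
    show "(\<integral>\<^sup>+\<gamma>. ennreal (v \<gamma>) \<partial>count_space UNIV) < \<infinity>" using tot by (simp add: v)
  qed (auto simp: v)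
  then obtain N :: "nat \<Rightarrow> 'g set" where N: "\<And>k. finite (N k)"
    "\<And>k L. finite L \<Longrightarrow> L \<inter> N k = {} \<Longrightarrow> sum v L < (1/4)^k"
    by metis
  \<comment> \<open>The sets \<open>N j\<close> secure the rate (1/4)^k; the elements with code at
    most k make the increasing sets exhaust the group.\<close>
  define Ks :: "nat \<Rightarrow> 'g set" where "Ks k = (\<Union>j\<le>k. N j \<union> {\<gamma>. to_nat \<gamma> = j})" for k
  have "finite {\<gamma>::'g. to_nat \<gamma> = j}" for j
    by (rule finite_subset[of _ "{from_nat j}"]) auto
  then have Ks_fin: "finite (Ks k)" for k
    using N(1) by (auto simp: Ks_def)
  have Ks_mono: "k \<le> j \<Longrightarrow> Ks k \<subseteq> Ks j" for k j
    unfolding Ks_def by (intro UN_mono) auto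
  have Ks_exhaust: "\<forall>\<^sub>F k in sequentially. K \<subseteq> Ks k" if "finite K" for K
  proof (rule eventually_sequentiallyI)
    fix k assume "Max (to_nat ` K) \<le> k"
    then have "to_nat \<gamma> \<le> k" if "\<gamma> \<in> K" for \<gamma>
      using that \<open>finite K\<close> by (meson Max_ge finite_imageI imageI order_trans)
    then show "K \<subseteq> Ks k" by (auto simp: Ks_def)
  qed
  have "L2_energy (m \<Otimes>\<^sub>M MC) (\<lambda>p. (case p of (\<alpha>, x) \<Rightarrow> S (Ks j) \<alpha> x) - (case p of (\<alpha>, x) \<Rightarrow> S (Ks k) \<alpha> x))
      \<le> ennreal ((1/4)^k)" if "k \<le> j" for k j
  proof -
    have "(\<lambda>p. (case p of (\<alpha>, x) \<Rightarrow> S (Ks j) \<alpha> x) - (case p of (\<alpha>, x) \<Rightarrow> S (Ks k) \<alpha> x))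
        = (\<lambda>(\<alpha>, x). S (Ks j - Ks k) \<alpha> x)"
      using S_diff[OF Ks_fin Ks_mono[OF that]] by auto
    moreover have "sum v (Ks j - Ks k) < (1/4)^k"
      using Ks_fin by (intro N(2)) (auto simp: Ks_def)
    ultimately show ?thesis
      by (simp add: S_energy Ks_fin ennreal_leI)
  qed
  then obtain Z0 where Z0 [measurable]: "Z0 \<in> borel_measurable (m \<Otimes>\<^sub>M MC)"
    and Z0_le: "\<And>k. L2_energy (m \<Otimes>\<^sub>M MC) (\<lambda>p. Z0 p - (case p of (\<alpha>, x) \<Rightarrow> S (Ks k) \<alpha> x)) \<le> ennreal ((1/4)^k)"
    by (rule L2_complete[of "\<lambda>k (\<alpha>, x). S (Ks k) \<alpha> x", rotated]) auto
  define Z where "Z \<alpha> x = Z0 (\<alpha>, x)" for \<alpha> x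
  have Z_meas [measurable]: "(\<lambda>(\<alpha>, x). Z \<alpha> x) \<in> borel_measurable (m \<Otimes>\<^sub>M MC)"
    by (simp add: Z_def)
  have D_meas [measurable]: "(\<lambda>(\<alpha>, x). Z \<alpha> x - S K \<alpha> x) \<in> borel_measurable (m \<Otimes>\<^sub>M MC)" for K
    using borel_measurable_diff[OF Z_meas S_meas[of K]] by (simp add: case_prod_unfold)
  have Z_le: "L2_energy (m \<Otimes>\<^sub>M MC) (\<lambda>(\<alpha>, x). Z \<alpha> x - S (Ks k) \<alpha> x) \<le> ennreal ((1/4)^k)" for k
    using Z0_le[of k] by (simp add: Z_def case_prod_unfold)
  have "(\<lambda>(\<alpha>, x). Z \<alpha> x - S (Ks 0) \<alpha> x) \<in> L2 (m \<Otimes>\<^sub>M MC)"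
    using Z_le[of 0] by (auto simp: L2_iff_energy intro: le_less_trans)
  moreover have "(\<lambda>(\<alpha>, x). S (Ks 0) \<alpha> x) \<in> L2 (m \<Otimes>\<^sub>M MC)"
    by (simp add: L2_iff_energy S_energy Ks_fin)
  ultimately have Z_L2: "(\<lambda>(\<alpha>, x). Z \<alpha> x) \<in> L2 (m \<Otimes>\<^sub>M MC)"
    using L2_add by (fastforce simp: case_prod_unfold)
  \<comment> \<open>The errors are summed over k before an exceptional set is taken: a finite
    integral of the sum makes \<open>?d k x\<close> summable in k, hence convergent to 0, for almost
    every x.\<close>
  let ?d = "\<lambda>k x. L2_energy m (\<lambda>\<alpha>. Z \<alpha> x - S (Ks k) \<alpha> x)"
  have "(\<integral>\<^sup>+x. (\<Sum>k. ?d k x) \<partial>MC) = (\<Sum>k. \<integral>\<^sup>+x. ?d k x \<partial>MC)"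
    by (rule nn_integral_suminf) (rule energy_slices(3)[OF D_meas])
  also have "\<dots> \<le> (\<Sum>k. ennreal ((1/4)^k))"
    by (rule suminf_le) (simp_all add: Z_le flip: energy_slices(1))
  also have "\<dots> < \<infinity>"
    by (subst suminf_ennreal2) (auto intro: summable_geometric)
  finally have d_fin: "AE x in MC. (\<Sum>k. ?d k x) \<noteq> \<infinity>"
    by (intro nn_integral_noteq_infinite borel_measurable_suminf_order energy_slices(3)[OF D_meas]) auto
  have "AE x in MC. (\<integral>\<^sup>+\<gamma>. ennreal ((norm (u \<gamma> x))\<^sup>2) \<partial>count_space UNIV) \<noteq> \<infinity>"
    using u_fin by (intro nn_integral_noteq_infinite borel_measurable_nn_integral_count_space) auto
  with d_fin AE_space have "AE x in MC. is_L2_fourier m (\<lambda>\<gamma>. u \<gamma> x) (\<lambda>\<alpha>. Z \<alpha> x)"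
  proof eventually_elim
    case (elim x)
    have S_L2: "(\<lambda>\<alpha>. S K \<alpha> x) \<in> L2 m" for K
      unfolding S_def by (rule fourier_partial_L2)
    have S_en: "finite K \<Longrightarrow> L2_energy m (\<lambda>\<alpha>. S K \<alpha> x) = ennreal (\<Sum>\<gamma>\<in>K. (norm (u \<gamma> x))\<^sup>2)" for K
      unfolding S_def by (rule fourier_partial_energy)
    have D_L2: "(\<lambda>\<alpha>. Z \<alpha> x - S (Ks k) \<alpha> x) \<in> L2 m" for k
    proof -
      have "?d k x < \<infinity>"
        using elim(1) sum_le_suminf[OF summableI, of "{k}" "\<lambda>k. ?d k x"] by (auto simp: less_top top_unique)
      with slice_measurable(1)[OF D_meas elim(2)] show ?thesis by (simp add: L2_iff_energy)
    qed
    have Zx: "(\<lambda>\<alpha>. Z \<alpha> x) \<in> L2 m"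
      using L2_add[OF D_L2[of 0] S_L2[of "Ks 0"]] by simp
    have d_lim: "(\<lambda>k. ?d k x) \<longlonglongrightarrow> 0"
    proof -
      have "summable (\<lambda>k. enn2real (?d k x))"
        using elim(1) by (intro summable_suminf_not_top) (auto simp: L2_energy_eq[OF D_L2])
      then have "(\<lambda>k. ennreal (enn2real (?d k x))) \<longlonglongrightarrow> ennreal 0"
        by (intro tendsto_ennrealI summable_LIMSEQ_zero)
      then show ?thesis by (simp add: L2_energy_eq[OF D_L2])
    qed
    have "((\<lambda>K. L2_energy m (\<lambda>\<alpha>. Z \<alpha> x - S K \<alpha> x)) \<longlongrightarrow> 0) (finite_subsets_at_top UNIV)"
    proof (rule tendsto_zero_ennreal)
      fix r :: real assume "0 < r"
      \<comment> \<open>The thresholds r/4 absorb the factors 2 in the bound for the energy of a sum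
        of two terms: the error along \<open>Ks\<close> and the tail beyond it.\<close>
      obtain N0 where N0: "finite N0" "\<And>L. finite L \<Longrightarrow> L \<inter> N0 = {} \<Longrightarrow> (\<Sum>\<gamma>\<in>L. (norm (u \<gamma> x))\<^sup>2) < r / 4"
        using count_space_tail[of "\<lambda>\<gamma>. (norm (u \<gamma> x))\<^sup>2" "r / 4"] elim(3) \<open>0 < r\<close> by (auto simp: less_top)
      have "\<forall>\<^sub>F k in sequentially. ?d k x < ennreal (r / 4)"
        using d_lim \<open>0 < r\<close> by (intro order_tendstoD) auto
      with Ks_exhaust[OF N0(1)] have "\<forall>\<^sub>F k in sequentially. N0 \<subseteq> Ks k \<and> ?d k x < ennreal (r / 4)"
        by (rule eventually_conj)
      then obtain k where k: "N0 \<subseteq> Ks k" "?d k x < ennreal (r / 4)"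
        using eventually_happens'[OF sequentially_bot] by blast
      show "\<forall>\<^sub>F K in finite_subsets_at_top UNIV. L2_energy m (\<lambda>\<alpha>. Z \<alpha> x - S K \<alpha> x) < ennreal r"
        unfolding eventually_finite_subsets_at_top
      proof (intro exI[of _ "Ks k"] conjI allI impI)
        fix K assume K: "finite K \<and> Ks k \<subseteq> K \<and> K \<subseteq> UNIV"
        have "Z \<alpha> x - S K \<alpha> x = (Z \<alpha> x - S (Ks k) \<alpha> x) + (- 1) * S (K - Ks k) \<alpha> x" for \<alpha>
        proof -
          have "S K \<alpha> x = S (Ks k) \<alpha> x + S (K - Ks k) \<alpha> x"
            using S_diff[of K "Ks k" \<alpha> x, symmetric] K by simp
          then show ?thesis by simp
        qed
        then have "L2_energy m (\<lambda>\<alpha>. Z \<alpha> x - S K \<alpha> x) \<le> 2 * ?d k x + 2 * L2_energy m (\<lambda>\<alpha>. (- 1) * S (K - Ks k) \<alpha> x)"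
          using L2_energy_add_le[OF L2_measurable[OF D_L2[of k]] L2_measurable[OF L2_scale[OF S_L2[of "K - Ks k"], of "- 1"]]]
          by presburger
        also have "L2_energy m (\<lambda>\<alpha>. (- 1) * S (K - Ks k) \<alpha> x) = ennreal (\<Sum>\<gamma>\<in>K - Ks k. (norm (u \<gamma> x))\<^sup>2)"
          using K by (subst L2_energy_scale[OF L2_measurable[OF S_L2]]) (simp add: S_en)
        also have "2 * ?d k x + 2 * \<dots>
            = ennreal (2 * (L2_norm m (\<lambda>\<alpha>. Z \<alpha> x - S (Ks k) \<alpha> x))\<^sup>2 + 2 * (\<Sum>\<gamma>\<in>K - Ks k. (norm (u \<gamma> x))\<^sup>2))"
          by (simp add: L2_energy_eq[OF D_L2] ennreal_plus ennreal_mult sum_nonneg)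
        also have "\<dots> < ennreal r"
        proof (rule ennreal_lessI[OF \<open>0 < r\<close>])
          have "(L2_norm m (\<lambda>\<alpha>. Z \<alpha> x - S (Ks k) \<alpha> x))\<^sup>2 < r / 4"
            using k(2) by (simp add: L2_energy_eq[OF D_L2] ennreal_less_iff)
          moreover have "(\<Sum>\<gamma>\<in>K - Ks k. (norm (u \<gamma> x))\<^sup>2) < r / 4"
            using K k(1) by (intro N0(2)) auto
          ultimately show "2 * (L2_norm m (\<lambda>\<alpha>. Z \<alpha> x - S (Ks k) \<alpha> x))\<^sup>2
              + 2 * (\<Sum>\<gamma>\<in>K - Ks k. (norm (u \<gamma> x))\<^sup>2) < r" by simp
        qed
        finally show "L2_energy m (\<lambda>\<alpha>. Z \<alpha> x - S K \<alpha> x) < ennreal r" .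
      qed (simp_all add: Ks_fin)
    qed
    then have "((\<lambda>K. L2_norm m (\<lambda>\<alpha>. Z \<alpha> x - S K \<alpha> x)) \<longlongrightarrow> 0) (finite_subsets_at_top UNIV)"
      by (rule L2_energy_tendsto_norm[rotated]) (rule L2_diff[OF Zx S_L2])
    then show ?case
      using Zx by (simp add: is_L2_fourier_def S_def)
  qed
  with Z_L2 show ?thesis
    unfolding is_zak_def u_def by blast
qed

lemma is_zak_zak: "\<psi> \<in> L2 M \<Longrightarrow> is_zak m M \<sigma> J C \<psi> (zak m M \<sigma> J C \<psi>)"
  unfolding zak_def by (rule someI_ex[OF is_zak_exists])

end

section \<open>Transfer of Riesz bounds\<close>

context zak_setting
begin

abbreviation "zk \<equiv> zak m M \<sigma> J C"

lemma zak_L2: "\<psi> \<in> L2 M \<Longrightarrow> (\<lambda>(\<alpha>, x). zk \<psi> \<alpha> x) \<in> L2 (m \<Otimes>\<^sub>M MC)"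
  using is_zak_zak[of \<psi>] by (simp add: is_zak_def)

lemma zak_fourier:
  "\<psi> \<in> L2 M \<Longrightarrow> AE x in MC. is_L2_fourier m (\<lambda>\<gamma>. action_rep \<sigma> J \<gamma> \<psi> x) (\<lambda>\<alpha>. zk \<psi> \<alpha> x)"
  using is_zak_zak[of \<psi>] by (simp add: is_zak_def)

lemma zak_combination_measurable:
  assumes "\<And>i. i \<in> F \<Longrightarrow> f i \<in> L2 M"
  shows "(\<lambda>(\<alpha>, x). \<Sum>i\<in>F. a i * (\<alpha> (g i) * zk (f i) \<alpha> x)) \<in> borel_measurable (m \<Otimes>\<^sub>M MC)"
proof -
  have [measurable]: "(\<lambda>p. zk (f i) (fst p) (snd p)) \<in> borel_measurable (m \<Otimes>\<^sub>M MC)" if "i \<in> F" for i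
    using L2_measurable[OF zak_L2[OF assms[OF that]]] by (simp add: case_prod_unfold)
  have "(\<lambda>p. \<Sum>i\<in>F. a i * (fst p (g i) * zk (f i) (fst p) (snd p))) \<in> borel_measurable (m \<Otimes>\<^sub>M MC)"
    by measurable
  then show ?thesis by (simp add: case_prod_unfold)
qed

text \<open>At a fixed x the combination has as its orbit sequence a sum of shifted orbit sequences
  of the f i, whose Fourier transform multiplies each \<open>zk (f i)\<close> by \<alpha> (g i).
  Parseval at each x, framed by the tiling identity and Tonelli, gives the claim; the Zak transform
  of the combination itself is not formed.\<close>

lemma zak_isometry:
  assumes "finite F" and f: "\<And>i. i \<in> F \<Longrightarrow> f i \<in> L2 M"
  shows "L2_energy M (\<lambda>x. \<Sum>i\<in>F. a i * action_rep \<sigma> J (g i) (f i) x)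
    = (\<integral>\<^sup>+\<alpha>. L2_energy MC (\<lambda>x. \<Sum>i\<in>F. a i * (\<alpha> (g i) * zk (f i) \<alpha> x)) \<partial>m)"
proof -
  let ?G = "\<lambda>x. \<Sum>i\<in>F. a i * action_rep \<sigma> J (g i) (f i) x"
  have "?G \<in> L2 M" by (intro L2_sum_scale action_rep_L2 f)
  then have [measurable]: "?G \<in> borel_measurable M" by (rule L2_measurable)
  have "AE x in M. x \<in> C \<longrightarrow> (\<forall>\<gamma>. action_rep \<sigma> J \<gamma> ?G x = (\<Sum>i\<in>F. a i * action_rep \<sigma> J (\<gamma> + g i) (f i) x))"
    using action_rep_sum[OF assms(1), of a g f] by eventually_elim (rule impI)
  then have rep: "AE x in MC. \<forall>\<gamma>. action_rep \<sigma> J \<gamma> ?G x = (\<Sum>i\<in>F. a i * action_rep \<sigma> J (\<gamma> + g i) (f i) x)"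
    by (simp add: AE_restrict_space_iff)
  have "AE x in MC. \<forall>i\<in>F. is_L2_fourier m (\<lambda>\<gamma>. action_rep \<sigma> J \<gamma> (f i) x) (\<lambda>\<alpha>. zk (f i) \<alpha> x)"
    using assms(1) by (intro AE_finite_allI zak_fourier f)
  then have parseval: "AE x in MC. (\<integral>\<^sup>+\<gamma>. ennreal ((norm (\<Sum>i\<in>F. a i * action_rep \<sigma> J (\<gamma> + g i) (f i) x))\<^sup>2) \<partial>count_space UNIV)
      = L2_energy m (\<lambda>\<alpha>. \<Sum>i\<in>F. a i * (\<alpha> (g i) * zk (f i) \<alpha> x))"
  proof eventually_elim
    case (elim x)
    then show ?case
      by (intro fourier_parseval fourier_sum fourier_scale fourier_shift assms(1)) auto
  qed
  have "L2_energy M ?G = (\<integral>\<^sup>+x. (\<integral>\<^sup>+\<gamma>. ennreal ((norm (action_rep \<sigma> J \<gamma> ?G x))\<^sup>2) \<partial>count_space UNIV) \<partial>MC)"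
    by (rule tiling_energy[OF tiling]) simp
  also have "\<dots> = (\<integral>\<^sup>+x. L2_energy m (\<lambda>\<alpha>. \<Sum>i\<in>F. a i * (\<alpha> (g i) * zk (f i) \<alpha> x)) \<partial>MC)"
  proof (rule nn_integral_cong_AE, use rep parseval in eventually_elim)
    case (elim x)
    show ?case unfolding elim(2)[symmetric] by (simp only: elim(1)[rule_format])
  qed
  also have "\<dots> = (\<integral>\<^sup>+\<alpha>. L2_energy MC (\<lambda>x. \<Sum>i\<in>F. a i * (\<alpha> (g i) * zk (f i) \<alpha> x)) \<partial>m)"
    using energy_slices(1,2)[OF zak_combination_measurable[of F f a g, OF f]] by simp
  finally show ?thesis .
qed

end

text \<open>All three quantities are continuous in the coefficient vector, and non-strict
  inequalities pass to limits.\<close>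

lemma L2_norm_combination_bounds_dense:
  fixes f :: "'i \<Rightarrow> 'a \<Rightarrow> complex"
  assumes "finite Q" and f: "\<And>i. i \<in> Q \<Longrightarrow> f i \<in> L2 M"
    and D: "\<And>X::complex set. open X \<Longrightarrow> X \<noteq> {} \<Longrightarrow> \<exists>d\<in>D. d \<in> X"
    and bounds: "\<And>c. c \<in> Q \<rightarrow>\<^sub>E D \<Longrightarrow> A * (\<Sum>i\<in>Q. (norm (c i))\<^sup>2) \<le> (L2_norm M (\<lambda>x. \<Sum>i\<in>Q. c i * f i x))\<^sup>2
      \<and> (L2_norm M (\<lambda>x. \<Sum>i\<in>Q. c i * f i x))\<^sup>2 \<le> B * (\<Sum>i\<in>Q. (norm (c i))\<^sup>2)"
  shows "A * (\<Sum>i\<in>Q. (norm (c i))\<^sup>2) \<le> (L2_norm M (\<lambda>x. \<Sum>i\<in>Q. c i * f i x))\<^sup>2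
      \<and> (L2_norm M (\<lambda>x. \<Sum>i\<in>Q. c i * f i x))\<^sup>2 \<le> B * (\<Sum>i\<in>Q. (norm (c i))\<^sup>2)"
proof -
  have "\<exists>d\<in>D. dist (c i) d < inverse (real (Suc n))" for n i
    using D[of "ball (c i) (inverse (real (Suc n)))"] by auto
  then have ex: "\<exists>d. d \<in> D \<and> dist (c i) d < inverse (real (Suc n))" for n i by (simp only: Bex_def)
  define d where "d n i = (SOME d. d \<in> D \<and> dist (c i) d < inverse (real (Suc n)))" for n i
  have d: "d n i \<in> D" "dist (c i) (d n i) < inverse (real (Suc n))" for n i
    using someI_ex[OF ex[of i n]] unfolding d_def by (rule conjunct1, rule conjunct2)
  \<comment> \<open>Restricting to Q places the approximants in the extensional product, which is
    countable for finite Q and countable D.\<close>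
  define e where "e n = restrict (d n) Q" for n
  have e: "e n \<in> Q \<rightarrow>\<^sub>E D" for n using d by (auto simp: e_def)
  have d_lim: "(\<lambda>n. d n i) \<longlonglongrightarrow> c i" for i
  proof (rule metric_tendsto_imp_tendsto[OF LIMSEQ_inverse_real_of_nat])
    show "\<forall>\<^sub>F n in sequentially. dist (d n i) (c i) \<le> dist (inverse (real (Suc n))) 0"
    proof (intro always_eventually allI)
      fix n show "dist (d n i) (c i) \<le> dist (inverse (real (Suc n))) 0"
        using d(2)[of i n] by (simp add: dist_commute[of "d n i"] del: of_nat_Suc)
    qed
  qed
  then have e_lim: "(\<lambda>n. e n i) \<longlonglongrightarrow> c i" if "i \<in> Q" for i
    using that by (simp add: e_def)
  let ?S = "\<lambda>c x. \<Sum>i\<in>Q. c i * f i x"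
  have S: "?S b \<in> L2 M" for b by (intro L2_sum_scale f)
  have "(\<lambda>n. L2_norm M (?S (e n)) - L2_norm M (?S c)) \<longlonglongrightarrow> 0"
  proof (rule tendsto_rabs_zero_cancel, rule tendsto_sandwich[OF _ _ tendsto_const])
    have "(\<lambda>n. \<Sum>i\<in>Q. norm (e n i - c i) * L2_norm M (f i)) \<longlonglongrightarrow> (\<Sum>i\<in>Q. norm (c i - c i) * L2_norm M (f i))"
      by (intro tendsto_intros e_lim)
    then show "(\<lambda>n. \<Sum>i\<in>Q. norm (e n i - c i) * L2_norm M (f i)) \<longlonglongrightarrow> 0" by simp
    have "\<bar>L2_norm M (?S (e n)) - L2_norm M (?S c)\<bar> \<le> (\<Sum>i\<in>Q. norm (e n i - c i) * L2_norm M (f i))" for n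
    proof -
      have "\<bar>L2_norm M (?S (e n)) - L2_norm M (?S c)\<bar> \<le> L2_norm M (\<lambda>x. ?S (e n) x - ?S c x)"
        by (rule L2_norm_diff_bound[OF S S])
      also have "\<dots> = L2_norm M (\<lambda>x. \<Sum>i\<in>Q. (e n i - c i) * f i x)"
        by (simp add: sum_subtractf left_diff_distrib)
      also have "\<dots> \<le> (\<Sum>i\<in>Q. L2_norm M (\<lambda>x. (e n i - c i) * f i x))"
        by (rule L2_norm_sum_le) (intro L2_scale f)
      finally show ?thesis by (simp add: L2_norm_scale)
    qed
    then show "\<forall>\<^sub>F n in sequentially. \<bar>L2_norm M (?S (e n)) - L2_norm M (?S c)\<bar>
        \<le> (\<Sum>i\<in>Q. norm (e n i - c i) * L2_norm M (f i))"
      by simp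
  qed simp
  then have "(\<lambda>n. L2_norm M (?S (e n))) \<longlonglongrightarrow> L2_norm M (?S c)"
    by (rule Lim_null[THEN iffD2])
  then have 1: "(\<lambda>n. (L2_norm M (?S (e n)))\<^sup>2) \<longlonglongrightarrow> (L2_norm M (?S c))\<^sup>2"
    by (rule tendsto_power)
  have 2: "(\<lambda>n. k * (\<Sum>i\<in>Q. (norm (e n i))\<^sup>2)) \<longlonglongrightarrow> k * (\<Sum>i\<in>Q. (norm (c i))\<^sup>2)" for k :: real
    by (intro tendsto_intros e_lim)
  show ?thesis
  proof
    show "A * (\<Sum>i\<in>Q. (norm (c i))\<^sup>2) \<le> (L2_norm M (?S c))\<^sup>2"
      by (rule LIMSEQ_le[OF 2 1]) (intro exI allI impI bounds[OF e, THEN conjunct1])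
    show "(L2_norm M (?S c))\<^sup>2 \<le> B * (\<Sum>i\<in>Q. (norm (c i))\<^sup>2)"
      by (rule LIMSEQ_le[OF 1 2]) (intro exI allI impI bounds[OF e, THEN conjunct2])
  qed
qed

context zak_setting
begin

text \<open>Collecting terms by generator turns the coefficients into the vector
  \<open>p \<alpha>\<close>, which varies with \<alpha>. The fibre hypothesis quantifies over c
  inside the a.e. statement, so it may be used at this vector before integrating.\<close>

lemma bounds_integrate:
  assumes "0 \<le> A" "0 \<le> B" and \<A>: "\<A> \<subseteq> L2 M" and F: "finite F" "F \<subseteq> UNIV \<times> \<A>"
    and L2: "AE \<alpha> in m. \<forall>\<phi>\<in>\<A>. zk \<phi> \<alpha> \<in> L2 MC"
    and fib: "AE \<alpha> in m. \<forall>c. A * (\<Sum>\<phi>\<in>snd ` F. (norm (c \<phi>))\<^sup>2) \<le> (L2_norm MC (\<lambda>x. \<Sum>\<phi>\<in>snd ` F. c \<phi> * zk \<phi> \<alpha> x))\<^sup>2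
      \<and> (L2_norm MC (\<lambda>x. \<Sum>\<phi>\<in>snd ` F. c \<phi> * zk \<phi> \<alpha> x))\<^sup>2 \<le> B * (\<Sum>\<phi>\<in>snd ` F. (norm (c \<phi>))\<^sup>2)"
  shows "A * (\<Sum>i\<in>F. (norm (a i))\<^sup>2) \<le> (L2_norm M (\<lambda>x. \<Sum>i\<in>F. a i * action_rep \<sigma> J (fst i) (snd i) x))\<^sup>2
    \<and> (L2_norm M (\<lambda>x. \<Sum>i\<in>F. a i * action_rep \<sigma> J (fst i) (snd i) x))\<^sup>2 \<le> B * (\<Sum>i\<in>F. (norm (a i))\<^sup>2)"
proof -
  define p where "p \<alpha> \<phi> = (\<Sum>i\<in>{i\<in>F. snd i = \<phi>}. a i * \<alpha> (fst i))" for \<alpha> \<phi>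
  have [measurable]: "(\<lambda>\<alpha>. p \<alpha> \<phi>) \<in> borel_measurable m" for \<phi>
    unfolding p_def by measurable
  have f: "snd i \<in> L2 M" if "i \<in> F" for i
    using subsetD[OF F(2) that] \<A> by (auto simp: mem_Times_iff)
  have split: "(\<Sum>i\<in>F. a i * (\<alpha> (fst i) * zk (snd i) \<alpha> x)) = (\<Sum>\<phi>\<in>snd ` F. p \<alpha> \<phi> * zk \<phi> \<alpha> x)" for \<alpha> x
  proof -
    have "(\<Sum>i\<in>F. a i * (\<alpha> (fst i) * zk (snd i) \<alpha> x))
        = (\<Sum>\<phi>\<in>snd ` F. \<Sum>i\<in>{i\<in>F. snd i = \<phi>}. a i * (\<alpha> (fst i) * zk (snd i) \<alpha> x))"
      using F(1) by (rule sum.image_gen)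
    also have "\<dots> = (\<Sum>\<phi>\<in>snd ` F. p \<alpha> \<phi> * zk \<phi> \<alpha> x)"
      unfolding p_def sum_distrib_right by (intro sum.cong refl) auto
    finally show ?thesis .
  qed
  have p_energy: "(\<integral>\<^sup>+\<alpha>. ennreal (k * (\<Sum>\<phi>\<in>snd ` F. (norm (p \<alpha> \<phi>))\<^sup>2)) \<partial>m) = ennreal (k * (\<Sum>i\<in>F. (norm (a i))\<^sup>2))"
    if "0 \<le> k" for k
  proof -
    have "(\<integral>\<^sup>+\<alpha>. ennreal (k * (\<Sum>\<phi>\<in>snd ` F. (norm (p \<alpha> \<phi>))\<^sup>2)) \<partial>m)
        = ennreal k * (\<Sum>\<phi>\<in>snd ` F. L2_energy m (\<lambda>\<alpha>. p \<alpha> \<phi>))"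
      unfolding L2_energy_def using that
      by (simp add: ennreal_mult sum_nonneg nn_integral_cmult nn_integral_sum flip: sum_ennreal)
    \<comment> \<open>Among indices with the same generator the group elements are distinct, so the
      characters in \<open>p \<alpha> \<phi>\<close> are orthonormal.\<close>
    also have "\<dots> = ennreal k * (\<Sum>\<phi>\<in>snd ` F. ennreal (\<Sum>i\<in>{i\<in>F. snd i = \<phi>}. (norm (a i))\<^sup>2))"
      unfolding p_def using F(1)
      by (intro arg_cong[where f = "(*) (ennreal k)"] sum.cong refl char_sum_energy)
        (auto simp: inj_on_def prod_eq_iff)
    also have "\<dots> = ennreal (k * (\<Sum>i\<in>F. (norm (a i))\<^sup>2))"
      using that sum.image_gen[OF F(1), of "\<lambda>i. (norm (a i))\<^sup>2" snd]
      by (simp add: sum_nonneg flip: ennreal_mult)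
    finally show ?thesis .
  qed
  let ?G = "\<lambda>x. \<Sum>i\<in>F. a i * action_rep \<sigma> J (fst i) (snd i) x"
  have "?G \<in> L2 M" by (intro L2_sum_scale action_rep_L2 f)
  then have G: "ennreal ((L2_norm M ?G)\<^sup>2) = (\<integral>\<^sup>+\<alpha>. L2_energy MC (\<lambda>x. \<Sum>\<phi>\<in>snd ` F. p \<alpha> \<phi> * zk \<phi> \<alpha> x) \<partial>m)"
    using zak_isometry[OF F(1), of snd a fst] f by (simp add: split L2_energy_eq)
  have fib': "AE \<alpha> in m. ennreal (A * (\<Sum>\<phi>\<in>snd ` F. (norm (p \<alpha> \<phi>))\<^sup>2)) \<le> L2_energy MC (\<lambda>x. \<Sum>\<phi>\<in>snd ` F. p \<alpha> \<phi> * zk \<phi> \<alpha> x)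
      \<and> L2_energy MC (\<lambda>x. \<Sum>\<phi>\<in>snd ` F. p \<alpha> \<phi> * zk \<phi> \<alpha> x) \<le> ennreal (B * (\<Sum>\<phi>\<in>snd ` F. (norm (p \<alpha> \<phi>))\<^sup>2))"
    using L2 fib
  proof eventually_elim
    case (elim \<alpha>)
    have "(\<lambda>x. \<Sum>\<phi>\<in>snd ` F. p \<alpha> \<phi> * zk \<phi> \<alpha> x) \<in> L2 MC"
      using elim(1) F(2) by (intro L2_sum_scale) auto
    then show ?case
      using elim(2)[rule_format, of "p \<alpha>"] by (auto simp: L2_energy_eq intro!: ennreal_leI)
  qed
  have "ennreal (A * (\<Sum>i\<in>F. (norm (a i))\<^sup>2)) \<le> ennreal ((L2_norm M ?G)\<^sup>2)"
    unfolding G p_energy[OF assms(1), symmetric]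
    by (rule nn_integral_mono_AE) (use fib' in eventually_elim, auto)
  moreover have "ennreal ((L2_norm M ?G)\<^sup>2) \<le> ennreal (B * (\<Sum>i\<in>F. (norm (a i))\<^sup>2))"
    unfolding G p_energy[OF assms(2), symmetric]
    by (rule nn_integral_mono_AE) (use fib' in eventually_elim, auto)
  ultimately show ?thesis
    using assms(2) by (simp add: sum_nonneg)
qed

text \<open>With product coefficients b \<gamma> * c \<phi> on K \<times> Q everything factors: the
  fibre vector is a trigonometric polynomial times the fixed combination, and the coefficient sum is
  a product of two sums. The polynomial then acts as a free test weight.\<close>

lemma bounds_localize_fixed:
  assumes \<A>: "\<A> \<subseteq> L2 M" and Q: "finite Q" "Q \<subseteq> \<A>"
    and bounds: "\<And>F a. finite F \<Longrightarrow> F \<subseteq> UNIV \<times> \<A> \<Longrightarrow>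
      A * (\<Sum>i\<in>F. (norm (a i :: complex))\<^sup>2) \<le> (L2_norm M (\<lambda>x. \<Sum>i\<in>F. a i * action_rep \<sigma> J (fst i) (snd i) x))\<^sup>2
    \<and> (L2_norm M (\<lambda>x. \<Sum>i\<in>F. a i * action_rep \<sigma> J (fst i) (snd i) x))\<^sup>2 \<le> B * (\<Sum>i\<in>F. (norm (a i))\<^sup>2)"
  shows "AE \<alpha> in m. A * (\<Sum>\<phi>\<in>Q. (norm (c \<phi>))\<^sup>2) \<le> (L2_norm MC (\<lambda>x. \<Sum>\<phi>\<in>Q. c \<phi> * zk \<phi> \<alpha> x))\<^sup>2
      \<and> (L2_norm MC (\<lambda>x. \<Sum>\<phi>\<in>Q. c \<phi> * zk \<phi> \<alpha> x))\<^sup>2 \<le> B * (\<Sum>\<phi>\<in>Q. (norm (c \<phi>))\<^sup>2)"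
proof -
  let ?s = "\<Sum>\<phi>\<in>Q. (norm (c \<phi>))\<^sup>2"
  let ?Z = "\<lambda>\<alpha> x. \<Sum>\<phi>\<in>Q. c \<phi> * zk \<phi> \<alpha> x"
  define h where "h \<alpha> = (L2_norm MC (?Z \<alpha>))\<^sup>2" for \<alpha>
  have QL2: "\<phi> \<in> L2 M" if "\<phi> \<in> Q" for \<phi> using that Q \<A> by auto
  have "AE \<alpha> in m. \<forall>\<phi>\<in>Q. zk \<phi> \<alpha> \<in> L2 MC"
    using Q(1) by (intro AE_finite_allI AE_slice_L2 zak_L2 QL2)
  then have Z_L2: "AE \<alpha> in m. ?Z \<alpha> \<in> L2 MC"
    by eventually_elim (intro L2_sum_scale, auto)
  \<comment> \<open>The factor \<alpha> 0 = 1 is inserted only to fit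
    \<open>zak_combination_measurable\<close> with all group elements equal to 0.\<close>
  have "(\<lambda>(\<alpha>, x). \<Sum>\<phi>\<in>Q. c \<phi> * (\<alpha> 0 * zk \<phi> \<alpha> x)) \<in> borel_measurable (m \<Otimes>\<^sub>M MC)"
    by (rule zak_combination_measurable) (rule QL2)
  from energy_slices(4)[OF this]
  have "(\<lambda>\<alpha>. L2_energy MC (\<lambda>x. \<Sum>\<phi>\<in>Q. c \<phi> * (\<alpha> 0 * zk \<phi> \<alpha> x))) \<in> borel_measurable m" .
  then have E_meas: "(\<lambda>\<alpha>. L2_energy MC (?Z \<alpha>)) \<in> borel_measurable m"
    by (rule measurable_cong[THEN iffD1, rotated]) (simp add: space_haar dual_zero)
  have h_eq: "AE \<alpha> in m. L2_energy MC (?Z \<alpha>) = ennreal (h \<alpha>)"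
    using Z_L2 by eventually_elim (simp add: h_def L2_energy_eq)
  have [measurable]: "h \<in> borel_measurable m"
  proof -
    have slices: "?Z \<alpha> \<in> borel_measurable MC" if "\<alpha> \<in> space m" for \<alpha>
      using that QL2 slice_measurable(2)[OF L2_measurable[OF zak_L2]]
      by (intro borel_measurable_sum borel_measurable_times) auto
    have "(\<lambda>\<alpha>. enn2real (L2_energy MC (?Z \<alpha>))) \<in> borel_measurable m"
      using E_meas by measurable
    then show ?thesis
      by (rule measurable_cong[THEN iffD1, rotated]) (simp add: h_def L2_norm_eq_energy[OF slices])
  qed
  have weighted: "integrable m (\<lambda>\<alpha>. (norm (\<Sum>\<gamma>\<in>K. b \<gamma> * \<alpha> \<gamma>))\<^sup>2 * h \<alpha>)
      \<and> A * (\<Sum>\<gamma>\<in>K. (norm (b \<gamma>))\<^sup>2) * ?s \<le> (\<integral>\<alpha>. (norm (\<Sum>\<gamma>\<in>K. b \<gamma> * \<alpha> \<gamma>))\<^sup>2 * h \<alpha> \<partial>m)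
      \<and> (\<integral>\<alpha>. (norm (\<Sum>\<gamma>\<in>K. b \<gamma> * \<alpha> \<gamma>))\<^sup>2 * h \<alpha> \<partial>m) \<le> B * (\<Sum>\<gamma>\<in>K. (norm (b \<gamma>))\<^sup>2) * ?s"
    if K: "finite K" for K b
  proof -
    let ?F = "K \<times> Q" and ?a = "\<lambda>(\<gamma>, \<phi>). b \<gamma> * c \<phi>"
    let ?p = "\<lambda>\<alpha>. \<Sum>\<gamma>\<in>K. b \<gamma> * \<alpha> \<gamma>"
    let ?G = "\<lambda>x. \<Sum>i\<in>?F. ?a i * action_rep \<sigma> J (fst i) (snd i) x"
    have F: "finite ?F" "?F \<subseteq> UNIV \<times> \<A>" using K Q by auto
    have sq: "(\<Sum>i\<in>?F. (norm (?a i))\<^sup>2) = (\<Sum>\<gamma>\<in>K. (norm (b \<gamma>))\<^sup>2) * ?s"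
      by (simp add: sum_product sum.cartesian_product case_prod_unfold norm_mult power_mult_distrib)
    have "?G \<in> L2 M" using QL2 by (intro L2_sum_scale action_rep_L2) auto
    then have "ennreal ((L2_norm M ?G)\<^sup>2) = L2_energy M ?G" by (simp add: L2_energy_eq)
    also have "\<dots> = (\<integral>\<^sup>+\<alpha>. L2_energy MC (\<lambda>x. \<Sum>i\<in>?F. ?a i * (\<alpha> (fst i) * zk (snd i) \<alpha> x)) \<partial>m)"
      using QL2 by (intro zak_isometry F) auto
    also have "\<dots> = (\<integral>\<^sup>+\<alpha>. L2_energy MC (\<lambda>x. ?p \<alpha> * ?Z \<alpha> x) \<partial>m)"
      by (simp add: sum_product sum.cartesian_product case_prod_unfold mult_ac)
    also have "\<dots> = (\<integral>\<^sup>+\<alpha>. ennreal ((norm (?p \<alpha>))\<^sup>2 * h \<alpha>) \<partial>m)"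
    proof (rule nn_integral_cong_AE, use Z_L2 h_eq in eventually_elim)
      case (elim \<alpha>)
      then show ?case
        using L2_energy_scale[OF L2_measurable[OF elim(1)], of "?p \<alpha>"]
        by (simp add: h_def ennreal_mult)
    qed
    finally have nn: "(\<integral>\<^sup>+\<alpha>. ennreal ((norm (?p \<alpha>))\<^sup>2 * h \<alpha>) \<partial>m) = ennreal ((L2_norm M ?G)\<^sup>2)" ..
    have nonneg: "0 \<le> (norm (?p \<alpha>))\<^sup>2 * h \<alpha>" for \<alpha> by (simp add: h_def)
    have int: "integrable m (\<lambda>\<alpha>. (norm (?p \<alpha>))\<^sup>2 * h \<alpha>)"
      by (rule integrableI_nonneg) (use nn nonneg in auto)
    have "(\<integral>\<alpha>. (norm (?p \<alpha>))\<^sup>2 * h \<alpha> \<partial>m) = (L2_norm M ?G)\<^sup>2"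
      using nn nonneg by (subst integral_eq_nn_integral) auto
    with int bounds[OF F, of ?a] show ?thesis unfolding sq by (simp add: mult.assoc)
  qed
  have h_int: "integrable m h"
  proof -
    \<comment> \<open>The constant test polynomial 1, the character at 0, recovers h itself.\<close>
    have "integrable m (\<lambda>\<alpha>. (norm (\<Sum>\<gamma>\<in>{0}. 1 * \<alpha> \<gamma>))\<^sup>2 * h \<alpha>)"
      using weighted[of "{0}" "\<lambda>_. 1"] by simp
    then show ?thesis
      by (rule Bochner_Integration.integrable_cong[THEN iffD1, rotated -1])
        (simp_all add: space_haar dual_zero)
  qed
  have p_int: "integrable m (\<lambda>\<alpha>. (norm (\<Sum>\<gamma>\<in>K. b \<gamma> * \<alpha> \<gamma>))\<^sup>2)"
    "(\<integral>\<alpha>. (norm (\<Sum>\<gamma>\<in>K. b \<gamma> * \<alpha> \<gamma>))\<^sup>2 \<partial>m) = (\<Sum>\<gamma>\<in>K. (norm (b \<gamma>))\<^sup>2)"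
    if "finite K" for K and b :: "'g \<Rightarrow> complex"
  proof -
    have L2: "(\<lambda>\<alpha>. \<Sum>\<gamma>\<in>K. b \<gamma> * \<alpha> \<gamma>) \<in> L2 m" by (rule char_sum_in_L2)
    then show "integrable m (\<lambda>\<alpha>. (norm (\<Sum>\<gamma>\<in>K. b \<gamma> * \<alpha> \<gamma>))\<^sup>2)" by (simp add: L2_def)
    have "ennreal ((L2_norm m (\<lambda>\<alpha>. \<Sum>\<gamma>\<in>K. b \<gamma> * \<alpha> \<gamma>))\<^sup>2) = ennreal (\<Sum>\<gamma>\<in>K. (norm (b \<gamma>))\<^sup>2)"
      using char_sum_energy[OF that, of "\<lambda>g. g" b] by (simp add: L2_energy_eq[OF L2])
    then show "(\<integral>\<alpha>. (norm (\<Sum>\<gamma>\<in>K. b \<gamma> * \<alpha> \<gamma>))\<^sup>2 \<partial>m) = (\<Sum>\<gamma>\<in>K. (norm (b \<gamma>))\<^sup>2)"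
      by (simp add: L2_norm_def sum_nonneg)
  qed
  have "AE \<alpha> in m. 0 \<le> h \<alpha> - A * ?s"
  proof (rule AE_nonneg_of_char_sums)
    fix K :: "'g set" and b :: "'g \<Rightarrow> complex" assume K: "finite K"
    have "(\<integral>\<alpha>. (norm (\<Sum>\<gamma>\<in>K. b \<gamma> * \<alpha> \<gamma>))\<^sup>2 * (h \<alpha> - A * ?s) \<partial>m)
        = (\<integral>\<alpha>. (norm (\<Sum>\<gamma>\<in>K. b \<gamma> * \<alpha> \<gamma>))\<^sup>2 * h \<alpha> - (norm (\<Sum>\<gamma>\<in>K. b \<gamma> * \<alpha> \<gamma>))\<^sup>2 * (A * ?s) \<partial>m)"
      by (simp only: right_diff_distrib)
    also have "\<dots> = (\<integral>\<alpha>. (norm (\<Sum>\<gamma>\<in>K. b \<gamma> * \<alpha> \<gamma>))\<^sup>2 * h \<alpha> \<partial>m) - (\<Sum>\<gamma>\<in>K. (norm (b \<gamma>))\<^sup>2) * (A * ?s)"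
      using weighted[OF K, of b] p_int[OF K, of b] by simp
    finally show "0 \<le> (\<integral>\<alpha>. (norm (\<Sum>\<gamma>\<in>K. b \<gamma> * \<alpha> \<gamma>))\<^sup>2 * (h \<alpha> - A * ?s) \<partial>m)"
      using weighted[OF K, of b] by (simp add: mult_ac)
  qed (use h_int in simp)
  moreover have "AE \<alpha> in m. 0 \<le> B * ?s - h \<alpha>"
  proof (rule AE_nonneg_of_char_sums)
    fix K :: "'g set" and b :: "'g \<Rightarrow> complex" assume K: "finite K"
    have "(\<integral>\<alpha>. (norm (\<Sum>\<gamma>\<in>K. b \<gamma> * \<alpha> \<gamma>))\<^sup>2 * (B * ?s - h \<alpha>) \<partial>m)
        = (\<integral>\<alpha>. (norm (\<Sum>\<gamma>\<in>K. b \<gamma> * \<alpha> \<gamma>))\<^sup>2 * (B * ?s) - (norm (\<Sum>\<gamma>\<in>K. b \<gamma> * \<alpha> \<gamma>))\<^sup>2 * h \<alpha> \<partial>m)"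
      by (simp only: right_diff_distrib)
    also have "\<dots> = (\<Sum>\<gamma>\<in>K. (norm (b \<gamma>))\<^sup>2) * (B * ?s) - (\<integral>\<alpha>. (norm (\<Sum>\<gamma>\<in>K. b \<gamma> * \<alpha> \<gamma>))\<^sup>2 * h \<alpha> \<partial>m)"
      using weighted[OF K, of b] p_int[OF K, of b] by simp
    finally show "0 \<le> (\<integral>\<alpha>. (norm (\<Sum>\<gamma>\<in>K. b \<gamma> * \<alpha> \<gamma>))\<^sup>2 * (B * ?s - h \<alpha>) \<partial>m)"
      using weighted[OF K, of b] by (simp add: mult_ac)
  qed (use h_int in simp)
  ultimately show ?thesis
    by eventually_elim (simp add: h_def)
qed

text \<open>The exceptional set found before depends on Q and c. There are countably many finite Q
  and, for c with values in a countable dense D, countably many c; continuity then reaches all c at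
  each remaining \<alpha>.\<close>

lemma bounds_localize:
  assumes \<A>: "\<A> \<subseteq> L2 M" "countable \<A>"
    and bounds: "\<And>F a. finite F \<Longrightarrow> F \<subseteq> UNIV \<times> \<A> \<Longrightarrow>
      A * (\<Sum>i\<in>F. (norm (a i :: complex))\<^sup>2) \<le> (L2_norm M (\<lambda>x. \<Sum>i\<in>F. a i * action_rep \<sigma> J (fst i) (snd i) x))\<^sup>2
    \<and> (L2_norm M (\<lambda>x. \<Sum>i\<in>F. a i * action_rep \<sigma> J (fst i) (snd i) x))\<^sup>2 \<le> B * (\<Sum>i\<in>F. (norm (a i))\<^sup>2)"
    and L2: "AE \<alpha> in m. \<forall>\<phi>\<in>\<A>. zk \<phi> \<alpha> \<in> L2 MC"
  shows "AE \<alpha> in m. \<forall>Q c. finite Q \<and> Q \<subseteq> \<A> \<longrightarrow>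
      A * (\<Sum>\<phi>\<in>Q. (norm (c \<phi>))\<^sup>2) \<le> (L2_norm MC (\<lambda>x. \<Sum>\<phi>\<in>Q. c \<phi> * zk \<phi> \<alpha> x))\<^sup>2
      \<and> (L2_norm MC (\<lambda>x. \<Sum>\<phi>\<in>Q. c \<phi> * zk \<phi> \<alpha> x))\<^sup>2 \<le> B * (\<Sum>\<phi>\<in>Q. (norm (c \<phi>))\<^sup>2)"
proof -
  obtain D :: "complex set" where D: "countable D" "\<And>X. open X \<Longrightarrow> X \<noteq> {} \<Longrightarrow> \<exists>d\<in>D. d \<in> X"
    using countable_dense_setE by (metis (no_types))
  let ?P = "\<lambda>\<alpha> Q c. A * (\<Sum>\<phi>\<in>Q. (norm (c \<phi> :: complex))\<^sup>2) \<le> (L2_norm MC (\<lambda>x. \<Sum>\<phi>\<in>Q. c \<phi> * zk \<phi> \<alpha> x))\<^sup>2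
      \<and> (L2_norm MC (\<lambda>x. \<Sum>\<phi>\<in>Q. c \<phi> * zk \<phi> \<alpha> x))\<^sup>2 \<le> B * (\<Sum>\<phi>\<in>Q. (norm (c \<phi>))\<^sup>2)"
  have "AE \<alpha> in m. \<forall>Q\<in>{Q. finite Q \<and> Q \<subseteq> \<A>}. \<forall>c\<in>Q \<rightarrow>\<^sub>E D. ?P \<alpha> Q c"
  proof (intro AE_ball_countable')
    show "countable {Q. finite Q \<and> Q \<subseteq> \<A>}"
      using countable_Collect_finite_subset[OF \<A>(2)] .
    fix Q assume "Q \<in> {Q. finite Q \<and> Q \<subseteq> \<A>}"
    then have Q: "finite Q" "Q \<subseteq> \<A>" by auto
    show "countable (Q \<rightarrow>\<^sub>E D)" using Q D(1) by (intro countable_PiE) auto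
    fix c show "AE \<alpha> in m. ?P \<alpha> Q c"
      by (rule bounds_localize_fixed[OF \<A>(1) Q bounds])
  qed
  with L2 show ?thesis
  proof eventually_elim
    case (elim \<alpha>)
    show ?case
    proof (intro allI impI)
      fix Q c assume Q: "finite Q \<and> Q \<subseteq> \<A>"
      show "?P \<alpha> Q c"
        by (rule L2_norm_combination_bounds_dense[OF _ _ D(2)]) (use Q elim in auto)
    qed
  qed
qed

end

lemma generator_in_closed_span:
  assumes "f \<in> S" "f \<in> L2 M"
  shows "f \<in> L2_closed_span M S"
proof -
  have "(\<lambda>x. \<Sum>h\<in>{f}. 1 * h x) \<in> lin_span S"
    unfolding lin_span_def using assms(1)
    by (intro CollectI exI[of _ "{f}"] exI[of _ "\<lambda>_. 1"]) auto
  then have "f \<in> lin_span S" by simp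
  moreover have "L2_norm M (\<lambda>x. f x - f x) = 0" by (simp add: L2_norm_def)
  ultimately show ?thesis
    using assms(2) unfolding L2_closed_span_def by force
qed

theorem theorem5p3:
  fixes m :: "('g::{ab_group_add,countable} \<Rightarrow> complex) measure"
    and M :: "'x measure"
    and \<sigma> :: "'g \<Rightarrow> 'x \<Rightarrow> 'x"
    and J\<^sub>\<sigma> :: "'g \<Rightarrow> 'x \<Rightarrow> real"
    and C :: "'x set"
    and \<A> :: "('x \<Rightarrow> complex) set"
    and A B :: real
  assumes "normalized_haar m"
    and "sigma_finite_measure M"
    and "L2_separable M"
    and "measurable_action M \<sigma>"
    and "is_jacobian M \<sigma> J\<^sub>\<sigma>"
    and "tiling_set M \<sigma> C"
    and "\<A> \<subseteq> L2 M" and "countable \<A>"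
    and "0 < A" and "A \<le> B"
  defines "V \<equiv> invariant_span M \<sigma> J\<^sub>\<sigma> \<A>"
    and "J \<equiv> range_function m M \<sigma> J\<^sub>\<sigma> C \<A>"
  shows "riesz_basis M V (UNIV \<times> \<A>) (\<lambda>(\<gamma>, \<phi>). action_rep \<sigma> J\<^sub>\<sigma> \<gamma> \<phi>) A B \<longleftrightarrow>
    (AE \<alpha> in m. riesz_basis (restrict_space M C) (J \<alpha>) \<A> (\<lambda>\<phi>. zak m M \<sigma> J\<^sub>\<sigma> C \<phi> \<alpha>) A B)"
proof -
  interpret zak_setting m M \<sigma> J\<^sub>\<sigma> C
    using assms(1-6)
    by (intro zak_setting.intro haar.intro jacobian_action.intro jacobian_action_axioms.intro zak_setting_axioms.intro)
  let ?N = "\<lambda>F a. (L2_norm M (\<lambda>x. \<Sum>i\<in>F. a i * action_rep \<sigma> J\<^sub>\<sigma> (fst i) (snd i) x))\<^sup>2"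
  let ?n = "\<lambda>\<alpha> Q c. (L2_norm MC (\<lambda>x. \<Sum>\<phi>\<in>Q. c \<phi> * zk \<phi> \<alpha> x))\<^sup>2"
  have gen: "(\<lambda>(\<gamma>, \<phi>). action_rep \<sigma> J\<^sub>\<sigma> \<gamma> \<phi>) ` (UNIV \<times> \<A>) = {action_rep \<sigma> J\<^sub>\<sigma> \<gamma> \<phi> | \<gamma> \<phi>. \<phi> \<in> \<A>}"
    by (auto simp: image_iff)
  have "{action_rep \<sigma> J\<^sub>\<sigma> \<gamma> \<phi> | \<gamma> \<phi>. \<phi> \<in> \<A>} \<subseteq> V"
    unfolding V_def invariant_span_def
    using assms(7) by (auto intro!: generator_in_closed_span action_rep_L2)
  \<comment> \<open>V is the closed span of the generators, so membership and completeness hold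
    automatically and only the inequalities remain.\<close>
  then have lhs: "riesz_basis M V (UNIV \<times> \<A>) (\<lambda>(\<gamma>, \<phi>). action_rep \<sigma> J\<^sub>\<sigma> \<gamma> \<phi>) A B \<longleftrightarrow>
      (\<forall>F a. finite F \<and> F \<subseteq> UNIV \<times> \<A> \<longrightarrow>
        A * (\<Sum>i\<in>F. (norm (a i))\<^sup>2) \<le> ?N F a \<and> ?N F a \<le> B * (\<Sum>i\<in>F. (norm (a i))\<^sup>2))"
    unfolding riesz_basis_def gen using assms(8-10)
    by (simp add: V_def invariant_span_def case_prod_unfold)
  \<comment> \<open>The chosen representatives have square-integrable slices only for almost every
    \<alpha>; countability of \<A> provides one null set, off which the fibre condition reduces to
    its inequalities as well.\<close>
  have L2: "AE \<alpha> in m. \<forall>\<phi>\<in>\<A>. zk \<phi> \<alpha> \<in> L2 MC"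
    using assms(7,8) by (intro AE_ball_countable' AE_slice_L2 zak_L2) auto
  have rhs: "riesz_basis MC (J \<alpha>) \<A> (\<lambda>\<phi>. zk \<phi> \<alpha>) A B \<longleftrightarrow>
      (\<forall>Q c. finite Q \<and> Q \<subseteq> \<A> \<longrightarrow>
        A * (\<Sum>\<phi>\<in>Q. (norm (c \<phi>))\<^sup>2) \<le> ?n \<alpha> Q c \<and> ?n \<alpha> Q c \<le> B * (\<Sum>\<phi>\<in>Q. (norm (c \<phi>))\<^sup>2))"
    if "\<forall>\<phi>\<in>\<A>. zk \<phi> \<alpha> \<in> L2 MC" for \<alpha>
  proof -
    have gen: "(\<lambda>\<phi>. zk \<phi> \<alpha>) ` \<A> = {zk \<phi> \<alpha> | \<phi>. \<phi> \<in> \<A>}" by auto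
    have "{zk \<phi> \<alpha> | \<phi>. \<phi> \<in> \<A>} \<subseteq> J \<alpha>"
      unfolding J_def range_function_def using that by (auto intro!: generator_in_closed_span)
    then show ?thesis
      unfolding riesz_basis_def gen using assms(8-10)
      by (simp add: J_def range_function_def)
  qed
  show ?thesis
  proof
    assume "riesz_basis M V (UNIV \<times> \<A>) (\<lambda>(\<gamma>, \<phi>). action_rep \<sigma> J\<^sub>\<sigma> \<gamma> \<phi>) A B"
    then have "AE \<alpha> in m. \<forall>Q c. finite Q \<and> Q \<subseteq> \<A> \<longrightarrow>
        A * (\<Sum>\<phi>\<in>Q. (norm (c \<phi>))\<^sup>2) \<le> ?n \<alpha> Q c \<and> ?n \<alpha> Q c \<le> B * (\<Sum>\<phi>\<in>Q. (norm (c \<phi>))\<^sup>2)"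
      unfolding lhs by (intro bounds_localize[OF assms(7,8) _ L2]) blast
    with L2 show "AE \<alpha> in m. riesz_basis MC (J \<alpha>) \<A> (\<lambda>\<phi>. zk \<phi> \<alpha>) A B"
      by eventually_elim (simp only: rhs simp_thms)
  next
    assume "AE \<alpha> in m. riesz_basis MC (J \<alpha>) \<A> (\<lambda>\<phi>. zk \<phi> \<alpha>) A B"
    with L2 have fib: "AE \<alpha> in m. \<forall>Q c. finite Q \<and> Q \<subseteq> \<A> \<longrightarrow>
        A * (\<Sum>\<phi>\<in>Q. (norm (c \<phi>))\<^sup>2) \<le> ?n \<alpha> Q c \<and> ?n \<alpha> Q c \<le> B * (\<Sum>\<phi>\<in>Q. (norm (c \<phi>))\<^sup>2)"
      by eventually_elim (simp only: rhs simp_thms)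
    show "riesz_basis M V (UNIV \<times> \<A>) (\<lambda>(\<gamma>, \<phi>). action_rep \<sigma> J\<^sub>\<sigma> \<gamma> \<phi>) A B"
      unfolding lhs
    proof (intro allI impI)
      fix F :: "('g \<times> ('x \<Rightarrow> complex)) set" and a :: "'g \<times> ('x \<Rightarrow> complex) \<Rightarrow> complex"
      assume F: "finite F \<and> F \<subseteq> UNIV \<times> \<A>"
      have "AE \<alpha> in m. \<forall>c. A * (\<Sum>\<phi>\<in>snd ` F. (norm (c \<phi>))\<^sup>2) \<le> ?n \<alpha> (snd ` F) c
          \<and> ?n \<alpha> (snd ` F) c \<le> B * (\<Sum>\<phi>\<in>snd ` F. (norm (c \<phi>))\<^sup>2)"
        using fib
      proof eventually_elim
        case (elim \<alpha>)
        have "finite (snd ` F) \<and> snd ` F \<subseteq> \<A>" using F by auto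
        with elim show ?case by blast
      qed
      then show "A * (\<Sum>i\<in>F. (norm (a i))\<^sup>2) \<le> ?N F a \<and> ?N F a \<le> B * (\<Sum>i\<in>F. (norm (a i))\<^sup>2)"
        using F assms(9,10) by (intro bounds_integrate[OF _ _ assms(7) _ _ L2]) auto
    qed
  qed
qed

end
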